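(* Let $A \in \mathbb{R}^{m\times n}$ with $m>n$ and $\|A\|_F^2 = n$. Let $\epsilon\in(0,1)$, $\delta\in(0,1)$, and set $C = \frac{2}{3}\,(6\|A\|^2 + 2\epsilon)\,(1-\log_n(\delta/2))$ and $s = C\epsilon^{-2} n\log n$. Let $A_s\in\mathbb{R}^{s\times n}$ be the random matrix obtained from $A$ by row sampling with sample size $s$ and sampling density $p_k = \|a_k\|_2^2/\|A\|_F^2$, $k=1,\dots,m$. Let $C_h>0$ be a fixed constant, and call $x\in\mathbb{R}^n$ a high frequency vector of $A^{\intercal}A$ if $\lambda_{\max}(A^{\intercal}A)\,\|x\|^2 \le C_h\,(A^{\intercal}A x, x)$. Then, with probability at least $1-\delta$, for all high frequency vectors $x$ of $A^{\intercal}A$, $$ (1 - C_h\epsilon)\,(A^{\intercal}A x, x) \;\le\; (A_s^{\intercal}A_s x, x) \;\le\; (1 + C_h\epsilon)\,(A^{\intercal}A x, x). $$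
   Context: Vectors carry the Euclidean norm $\|\cdot\|=\|\cdot\|_2$ and inner product $(\cdot,\cdot)$. For a matrix, $\|\cdot\|$ is the spectral norm and $\|\cdot\|_F$ the Frobenius norm; $\lambda_{\max}$ denotes the largest eigenvalue of a symmetric matrix. The rows of $A$ are denoted $a_1,\dots,a_m$ (row vectors). Here $\log$ is the natural logarithm and $\log_n$ the logarithm to base $n$ (so $n\ge 2$); $s$ is a sample size, hence a positive integer. Row sampling: given $A\in\mathbb{R}^{m\times n}$, a probability mass function $\{p_k\}_{k=1}^m$ and a sample size $s$, draw indices $i_1,\dots,i_s\in\{1,\dots,m\}$ independently and identically distributed with $\Pr\{i_t=k\}=p_k$. Let $S\in\mathbb{R}^{s\times m}$ be the matrix with $S_{t,i_t} = 1/(s\,p_{i_t})^{1/2}$ for $t=1,\dots,s$ and all other entries zero. The sampled matrix is $A_s = SA$. Thus $A_s^{\intercal}A_s = \frac1s\sum_{t=1}^s \frac{1}{p_{i_t}} a_{i_t}^{\intercal}a_{i_t}$. *)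

theory Defs
  imports "HOL-Probability.Probability"
begin

abbreviation spectral_norm :: "real^'n^'m \<Rightarrow> real" where
  "spectral_norm A \<equiv> onorm ((*v) A)"

text \<open>The library norm of a vector of vectors is the Euclidean norm of all its entries, i.e. the
  Frobenius norm.\<close>

abbreviation frobenius_norm :: "real^'n^'m \<Rightarrow> real" where
  "frobenius_norm A \<equiv> norm A"

lemma frobenius_norm_sq: "(frobenius_norm (A :: real^'n^'m))\<^sup>2 = (\<Sum>k\<in>UNIV. \<Sum>j\<in>UNIV. (A $ k $ j)\<^sup>2)"
  by (simp add: norm_vec_def L2_set_def sum_nonneg)

definition eigenvalues :: "real^'n^'n \<Rightarrow> real set" where
  "eigenvalues B = {l. \<exists>v. v \<noteq> 0 \<and> B *v v = l *\<^sub>R v}"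

text \<open>Only meaningful if \<open>B\<close> has a real eigenvalue, e.g. if it is symmetric.\<close>

definition lambda_max :: "real^'n^'n \<Rightarrow> real" where
  "lambda_max B = Max (eigenvalues B)"

text \<open>The indices drawn are random variables \<open>I t\<close> on a probability space \<open>M\<close>; the type \<open>'s\<close>
  indexes the draws, so the sample size is \<open>CARD('s)\<close>.\<close>

definition iid_draws ::
    "'w measure \<Rightarrow> ('m::finite \<Rightarrow> real) \<Rightarrow> ('s::finite \<Rightarrow> 'w \<Rightarrow> 'm) \<Rightarrow> bool" where
  "iid_draws M p I \<longleftrightarrow> prob_space M \<and>
     prob_space.indep_vars M (\<lambda>_. count_space UNIV) I UNIV \<and>
     (\<forall>t k. \<P>(\<omega> in M. I t \<omega> = k) = p k)"

text \<open>For an index \<open>i t\<close> with \<open>p (i t) = 0\<close> the entry below is \<open>1 / 0 = 0\<close>; such an index is drawn with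
  probability zero.\<close>

definition sampling_matrix :: "('m::finite \<Rightarrow> real) \<Rightarrow> ('s::finite \<Rightarrow> 'm) \<Rightarrow> real^'m^'s" where
  "sampling_matrix p i = (\<chi> t k. if k = i t then 1 / sqrt (real CARD('s) * p (i t)) else 0)"

definition row_sample :: "real^'n^'m \<Rightarrow> ('m \<Rightarrow> real) \<Rightarrow> ('s::finite \<Rightarrow> 'm) \<Rightarrow> real^'n^'s" where
  "row_sample A p i = sampling_matrix p i ** A"

definition row_density :: "real^'n^'m \<Rightarrow> 'm \<Rightarrow> real" where
  "row_density A k = (norm (row k A))\<^sup>2 / (frobenius_norm A)\<^sup>2"

definition high_frequency :: "real \<Rightarrow> real^'n^'n \<Rightarrow> real^'n \<Rightarrow> bool" where
  "high_frequency C\<^sub>h B x \<longleftrightarrow> lambda_max B * (norm x)\<^sup>2 \<le> C\<^sub>h * ((B *v x) \<bullet> x)"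

end

theory Submission
  imports Defs
begin

text \<open>
Write \<open>a\<^sub>k\<close> for the rows of \<open>A\<close>, \<open>u\<^sub>k = a\<^sub>k / \<parallel>a\<^sub>k\<parallel>\<close>, \<open>n\<close> and \<open>s\<close> for the
number of columns and the sample size, and \<open>\<kappa>\<close> for the largest eigenvalue of the Gram matrix.
Since \<open>\<parallel>A\<parallel>\<^sub>F\<^sup>2 = n\<close>, the sampled Gram matrix is \<open>n / s\<close> times the sum of the projections
\<open>u u\<^sup>T\<close> over the drawn indices, and each such projection has mean \<open>A\<^sup>T A / n\<close>. A high frequency
vector \<open>x\<close> satisfies \<open>\<kappa> \<parallel>x\<parallel>\<^sup>2 \<le> C\<^sub>h (A\<^sup>T A x, x)\<close>, so the claim follows once the sampled form
deviates from \<open>\<parallel>A x\<parallel>\<^sup>2\<close> by at most \<open>\<epsilon> \<kappa> \<parallel>x\<parallel>\<^sup>2\<close>. Required is therefore a tail bound for the spectral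
norm of a sum of independent random matrices.

The tail bound is obtained by Chernoff's method with the trace exponential, and the fact that the summands
are multiples of projections of rank one keeps it elementary. Let \<open>f\<close> and \<open>g\<close> be self-adjoint and
\<open>u\<close> a unit vector, and put \<open>\<theta>(x) = e\<^sup>x - 1\<close> for \<open>x \<ge> 0\<close> and \<open>\<theta>(x) = x e\<^sup>x\<close> for
\<open>x < 0\<close>. The first ingredient is
\<open>tr exp (f + x u u\<^sup>T) \<le> tr exp f + \<theta>(x) (exp f u, u)\<close>, which is
\<open>trace_exp_rank_one_update\<close>. The second is convexity of the trace exponential,
\<open>tr exp f + tr ((g - f) exp f) \<le> tr exp g\<close>, which is \<open>trace_exp_klein\<close>. Averaging
the first over a random unit vector and feeding the result into the second shows that replacing the mean matrix \<open>\<theta>(x) E u u\<^sup>T\<close> by the random matrix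
\<open>x u u\<^sup>T\<close> does not increase the expected trace exponential. Starting from
\<open>- s \<theta>(x) E u u\<^sup>T\<close> and replacing one summand after the other therefore gives
\<open>E tr exp (x \<Sum>\<^sub>t u\<^sub>t u\<^sub>t\<^sup>T - s \<theta>(x) E u u\<^sup>T) \<le> n\<close>, where \<open>u\<^sub>t\<close> is the \<open>t\<close>-th random vector.
Markov's inequality turns this into \<open>rank_one_chernoff\<close>; as \<open>\<theta>(x) - x \<le> x\<^sup>2\<close>, it is
a bound of Bernstein type for both signs of \<open>x\<close>. The choice \<open>x = \<plusminus> \<epsilon> / 2\<close> makes each tail at most
\<open>\<delta> / 2\<close>, using that \<open>\<kappa>\<close> and \<open>\<parallel>A\<parallel>\<^sup>2\<close> are at least one, both being at least
\<open>\<parallel>A\<parallel>\<^sub>F\<^sup>2 / n\<close>.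

The rank-one inequality for \<open>x \<ge> 0\<close> is proved for powers instead of the exponential: for positive
semidefinite \<open>f\<close>, induction on \<open>l\<close> gives
\<open>(f\<^sup>k (f + x u u\<^sup>T)\<^sup>l u, u) \<le> (f\<^sup>k (f + x)\<^sup>l u, u)\<close>, where the step is Chebyshev's sum
inequality on the spectrum of \<open>f\<close>. For \<open>x < 0\<close> it follows by combining convexity with the positive case.
\<close>

section \<open>Spectral decomposition of self-adjoint maps\<close>

definition self_adjoint :: "('a::euclidean_space \<Rightarrow> 'a) \<Rightarrow> bool" where
  "self_adjoint f \<longleftrightarrow> linear f \<and> (\<forall>x y. f x \<bullet> y = x \<bullet> f y)"

text \<open>The eigenvalue belonging to \<open>e\<close> is written \<open>f e \<bullet> e\<close>, which spares a second component and
makes sense for every unit vector.\<close>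

definition eigenbasis :: "('a::euclidean_space \<Rightarrow> 'a) \<Rightarrow> 'a set \<Rightarrow> bool" where
  "eigenbasis f E \<longleftrightarrow> finite E \<and> pairwise orthogonal E \<and> (\<forall>e\<in>E. norm e = 1) \<and> span E = UNIV \<and>
     (\<forall>e\<in>E. f e = (f e \<bullet> e) *\<^sub>R e)"

lemma self_adjointD:
  assumes "self_adjoint f"
  shows "f x \<bullet> y = x \<bullet> f y" "f (x + y) = f x + f y" "f (c *\<^sub>R x) = c *\<^sub>R f x" "f 0 = 0" "linear f"
  using assms by (auto simp: self_adjoint_def linear_add linear_scale linear_0)

text \<open>The form \<open>q v = \<lambda> \<parallel>v\<parallel>\<^sup>2 - (f v, v)\<close>, with \<open>\<lambda>\<close> the maximum of the Rayleigh quotient, is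
nonnegative and vanishes at \<open>e\<close>. Moving from \<open>e\<close> in the direction of the residual
\<open>r = \<lambda> e - f e\<close> changes it by \<open>2 t \<parallel>r\<parallel>\<^sup>2 + t\<^sup>2 q r\<close>, which takes negative values
unless \<open>r = 0\<close>.\<close>

lemma maximizer_eigenvector:
  assumes f: "self_adjoint f" and V: "subspace V" "f ` V \<subseteq> V"
    and e: "e \<in> V" "norm e = 1" and max: "\<And>v. v \<in> V \<Longrightarrow> norm v = 1 \<Longrightarrow> f v \<bullet> v \<le> f e \<bullet> e"
  shows "f e = (f e \<bullet> e) *\<^sub>R e"
proof -
  define l where "l = f e \<bullet> e"
  define q where "q v = l * (v \<bullet> v) - f v \<bullet> v" for v
  have q0: "0 \<le> q v" if "v \<in> V" for v
  proof (cases "v = 0")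
    case False
    have "f (v /\<^sub>R norm v) \<bullet> (v /\<^sub>R norm v) \<le> l"
      unfolding l_def using that False V(1) by (intro max) (auto simp: subspace_scale)
    then have "(f v \<bullet> v) / (norm v)\<^sup>2 \<le> l"
      by (simp add: self_adjointD[OF f] power2_eq_square divide_inverse mult.commute mult.left_commute)
    then have "f v \<bullet> v \<le> l * (norm v)\<^sup>2" using False by (simp add: divide_le_eq)
    then show ?thesis by (simp add: q_def dot_square_norm)
  qed (simp add: q_def)
  define r where "r = l *\<^sub>R e - f e"
  have r: "r \<in> V" unfolding r_def using V e by (auto intro: subspace_diff subspace_scale)
  have qe: "q e = 0" using e by (simp add: q_def l_def dot_square_norm)
  have exp: "q (e + t *\<^sub>R r) = 2 * t * (r \<bullet> r) + t\<^sup>2 * q r" for t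
  proof -
    have "f r \<bullet> e = f e \<bullet> r" using self_adjointD(1)[OF f] by (simp add: inner_commute)
    then have "q (e + t *\<^sub>R r) = q e + 2 * t * ((l *\<^sub>R e - f e) \<bullet> r) + t\<^sup>2 * q r"
      unfolding q_def by (simp add: self_adjointD[OF f] inner_add inner_diff algebra_simps power2_eq_square inner_commute)
    then show ?thesis by (simp add: qe r_def)
  qed
  have ineq: "0 \<le> 2 * t * (r \<bullet> r) + t\<^sup>2 * q r" for t
    unfolding exp[symmetric] using V e r by (intro q0) (auto intro: subspace_add subspace_scale)
  have "r \<bullet> r = 0"
  proof (cases "q r = 0")
    case True
    then have "r \<bullet> r \<le> 0" using ineq[of "-1"] by simp
    then show ?thesis using inner_ge_zero[of r] by linarith
  next
    case False
    then have "q r > 0" using q0[OF r] by simp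
    then have "0 \<le> - ((r \<bullet> r)\<^sup>2 / q r)"
      using ineq[of "- (r \<bullet> r) / q r"] by (simp add: power2_eq_square field_simps)
    then have "(r \<bullet> r)\<^sup>2 / q r \<le> 0" by linarith
    then show ?thesis using \<open>q r > 0\<close> by (simp add: divide_le_0_iff)
  qed
  then show ?thesis by (simp add: r_def l_def)
qed

text \<open>Split off a maximizer of the Rayleigh quotient; its orthogonal complement is again invariant and has
smaller dimension.\<close>

lemma invariant_subspace_eigenbasis:
  assumes f: "self_adjoint f"
  shows "subspace V \<Longrightarrow> f ` V \<subseteq> V \<Longrightarrow>
    \<exists>E. finite E \<and> pairwise orthogonal E \<and> (\<forall>e\<in>E. norm e = 1 \<and> f e = (f e \<bullet> e) *\<^sub>R e) \<and> span E = V"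
proof (induction "dim V" arbitrary: V rule: less_induct)
  case less
  show ?case
  proof (cases "V = {0}")
    case True
    then show ?thesis by (intro exI[of _ "{}"]) auto
  next
    case False
    then obtain w where w: "w \<in> V" "w \<noteq> 0" using less.prems(1) subspace_0 by blast
    let ?K = "V \<inter> sphere 0 1"
    have "compact ?K"
      using less.prems(1) by (intro closed_Int_compact closed_subspace) auto
    moreover have "?K \<noteq> {}"
      using w subspace_scale[OF less.prems(1) w(1), of "inverse (norm w)"] by fastforce
    moreover have "continuous_on ?K (\<lambda>v. f v \<bullet> v)"
    proof (intro continuous_on_inner continuous_on_id)
      show "continuous_on ?K f"
        using self_adjointD(5)[OF f] by (simp add: linear_continuous_on linear_conv_bounded_linear)
    qed
    ultimately obtain e where e: "e \<in> ?K" "\<forall>v\<in>?K. f v \<bullet> v \<le> f e \<bullet> e"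
      using continuous_attains_sup[of ?K "\<lambda>v. f v \<bullet> v"] by blast
    then have eV: "e \<in> V" "norm e = 1" by auto
    have eig: "f e = (f e \<bullet> e) *\<^sub>R e"
      by (rule maximizer_eigenvector[OF f less.prems eV]) (use e in auto)
    \<comment> \<open>The complement of \<open>e\<close> inside \<open>V\<close>, to which the induction hypothesis applies.\<close>
    define W where "W = {v \<in> V. v \<bullet> e = 0}"
    have W: "subspace W" unfolding W_def using less.prems(1)
      by (auto simp: subspace_def inner_add_left)
    have "W \<subseteq> V" "e \<notin> W" using eV by (auto simp: W_def dot_square_norm)
    then have "W \<subset> V" using eV by auto
    then have "dim W < dim V" using W less.prems(1) by (metis dim_psubset span_eq_iff)
    moreover have "f ` W \<subseteq> W"
    proof safe
      fix v assume v: "v \<in> W"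
      have "f v \<bullet> e = v \<bullet> f e" by (rule self_adjointD(1)[OF f])
      also have "\<dots> = (f e \<bullet> e) * (v \<bullet> e)" by (subst eig) simp
      finally have "f v \<bullet> e = (f e \<bullet> e) * (v \<bullet> e)" .
      then show "f v \<in> W" using v less.prems(2) by (auto simp: W_def)
    qed
    ultimately obtain E where E: "finite E" "pairwise orthogonal E"
      "\<forall>e\<in>E. norm e = 1 \<and> f e = (f e \<bullet> e) *\<^sub>R e" "span E = W"
      using less.hyps W by blast
    have EW: "d \<in> E \<Longrightarrow> d \<in> W" for d using E(4) span_base by blast
    have "span (insert e E) = V"
    proof (intro equalityI subsetI)
      fix v assume "v \<in> span (insert e E)"
      moreover have "insert e E \<subseteq> V" using EW eV by (auto simp: W_def)
      ultimately show "v \<in> V" using less.prems(1) span_minimal by blast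
    next
      fix v assume "v \<in> V"
      then have "v - (v \<bullet> e) *\<^sub>R e \<in> W" using less.prems(1) eV
        by (auto simp: W_def subspace_diff subspace_scale inner_diff_left dot_square_norm)
      then show "v \<in> span (insert e E)" unfolding span_insert E(4) by auto
    qed
    moreover have "pairwise orthogonal (insert e E)"
      using E(2) EW by (auto simp: pairwise_insert W_def orthogonal_def inner_commute)
    ultimately show ?thesis using E eV eig by (intro exI[of _ "insert e E"]) auto
  qed
qed

theorem eigenbasis_exists: "self_adjoint f \<Longrightarrow> \<exists>E. eigenbasis f E"
  using invariant_subspace_eigenbasis[of f UNIV] by (auto simp: eigenbasis_def)

lemma eigenbasis_parseval:
  assumes "eigenbasis f E"
  shows "(\<Sum>e\<in>E. (u \<bullet> e) * (v \<bullet> e)) = u \<bullet> v"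
proof -
  have "(\<Sum>e\<in>E. (u \<bullet> e) *\<^sub>R e) = u"
    using assms by (intro orthonormal_basis_expand) (auto simp: eigenbasis_def)
  then have "u \<bullet> v = (\<Sum>e\<in>E. (u \<bullet> e) *\<^sub>R e) \<bullet> v" by simp
  also have "\<dots> = (\<Sum>e\<in>E. (u \<bullet> e) * (v \<bullet> e))"
    by (simp add: inner_sum_left inner_commute[of v])
  finally show ?thesis by simp
qed

lemma eigenbasis_parseval_sq:
  assumes "eigenbasis f E"
  shows "(\<Sum>e\<in>E. (v \<bullet> e)\<^sup>2) = (norm v)\<^sup>2"
  using eigenbasis_parseval[OF assms, of v v] by (simp add: power2_eq_square dot_square_norm)

lemma eigenbasis_finite: "eigenbasis f E \<Longrightarrow> finite E"
  by (simp add: eigenbasis_def)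

lemma eigenbasis_norm: "eigenbasis f E \<Longrightarrow> e \<in> E \<Longrightarrow> norm e = 1"
  by (simp add: eigenbasis_def)

lemma eigenbasis_inner:
  assumes f: "self_adjoint f" and E: "eigenbasis f E" and e: "e \<in> E"
  shows "f v \<bullet> e = (f e \<bullet> e) * (v \<bullet> e)"
proof -
  have "f v \<bullet> e = v \<bullet> f e" by (rule self_adjointD(1)[OF f])
  also have "\<dots> = v \<bullet> ((f e \<bullet> e) *\<^sub>R e)" using E e unfolding eigenbasis_def by metis
  finally show ?thesis by simp
qed

lemma eigenbasis_quadratic_form:
  assumes f: "self_adjoint f" and E: "eigenbasis f E"
  shows "f v \<bullet> v = (\<Sum>e\<in>E. (f e \<bullet> e) * (v \<bullet> e)\<^sup>2)"
proof -
  have "f v \<bullet> v = (\<Sum>e\<in>E. (f v \<bullet> e) * (v \<bullet> e))" by (rule eigenbasis_parseval[OF E, symmetric])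
  also have "\<dots> = (\<Sum>e\<in>E. (f e \<bullet> e) * (v \<bullet> e)\<^sup>2)"
    by (intro sum.cong refl) (simp only: eigenbasis_inner[OF f E, of _ v] power2_eq_square mult.assoc)
  finally show ?thesis .
qed

lemma eigenbasis_card:
  fixes f :: "'a::euclidean_space \<Rightarrow> 'a"
  assumes "eigenbasis f E"
  shows "card E = DIM('a)"
proof -
  have "independent E"
    using assms by (intro pairwise_orthogonal_independent) (fastforce simp: eigenbasis_def)+
  then have "card E = dim E" by (simp add: dim_eq_card_independent)
  also have "\<dots> = dim (span E)" by (rule dim_span[symmetric])
  also have "\<dots> = DIM('a)" using assms unfolding eigenbasis_def by (simp only: dim_UNIV)
  finally show ?thesis .
qed

lemma self_adjoint_add:
  "self_adjoint f \<Longrightarrow> self_adjoint g \<Longrightarrow> self_adjoint (\<lambda>v. f v + g v)"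
  unfolding self_adjoint_def by (auto intro: linear_compose_add simp: inner_add)

lemma self_adjoint_scale: "self_adjoint f \<Longrightarrow> self_adjoint (\<lambda>v. c *\<^sub>R f v)"
  unfolding self_adjoint_def by (auto intro: linear_compose_scale_right)

lemma self_adjoint_id: "self_adjoint (\<lambda>v. v)"
  unfolding self_adjoint_def by (auto simp: linear_id[unfolded id_def])

lemma self_adjoint_zero: "self_adjoint (\<lambda>v. 0)"
  unfolding self_adjoint_def by (auto simp: linear_zero)

lemma self_adjoint_sum:
  "(\<And>k. k \<in> K \<Longrightarrow> self_adjoint (f k)) \<Longrightarrow> self_adjoint (\<lambda>v. \<Sum>k\<in>K. f k v)"
  by (induction K rule: infinite_finite_induct) (auto intro: self_adjoint_add simp: self_adjoint_zero)

lemma self_adjoint_rank_one: "self_adjoint (\<lambda>v. (x * (u \<bullet> v)) *\<^sub>R u)"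
  unfolding self_adjoint_def
  by (auto intro!: linearI simp: inner_add_right algebra_simps inner_commute)

text \<open>Shifting by a multiple of the identity keeps the eigenbasis, so inequalities between exponential sums,
which only gain a common factor, may be proved for positive semidefinite maps.\<close>

lemma eigenbasis_shift:
  assumes "eigenbasis f E"
  shows "eigenbasis (\<lambda>v. f v + c *\<^sub>R v) E"
proof -
  have "f e + c *\<^sub>R e = ((f e + c *\<^sub>R e) \<bullet> e) *\<^sub>R e" if "e \<in> E" for e
  proof -
    have "f e = (f e \<bullet> e) *\<^sub>R e" "norm e = 1" using assms that unfolding eigenbasis_def by blast+
    then have "((f e + c *\<^sub>R e) \<bullet> e) *\<^sub>R e = (f e \<bullet> e) *\<^sub>R e + c *\<^sub>R e"
      by (simp add: inner_add_left dot_square_norm scaleR_add_left)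
    with \<open>f e = (f e \<bullet> e) *\<^sub>R e\<close> show ?thesis by simp
  qed
  with assms show ?thesis by (simp add: eigenbasis_def)
qed

lemma shifted_eigenvalue:
  "eigenbasis f E \<Longrightarrow> e \<in> E \<Longrightarrow> (f e + c *\<^sub>R e) \<bullet> e = f e \<bullet> e + c"
  by (simp add: eigenbasis_def inner_add_left dot_square_norm)

section \<open>Convexity of the trace exponential\<close>

text \<open>The squares \<open>(v \<bullet> e)\<^sup>2\<close> are probability weights with respect to which the eigenvalues have mean
\<open>f v \<bullet> v\<close>; averaging the tangent line of \<open>exp\<close> at \<open>t\<close> gives the bound. The point \<open>t\<close>
is left free: at \<open>t = f v \<bullet> v\<close> this is Jensen's inequality, and for \<open>v\<close> an eigenvector of another
map it yields the convexity of the trace exponential.\<close>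

lemma exp_quadratic_form_tangent:
  assumes f: "self_adjoint f" and E: "eigenbasis f E" and v: "norm v = 1"
  shows "exp t * (1 + f v \<bullet> v - t) \<le> (\<Sum>e\<in>E. exp (f e \<bullet> e) * (v \<bullet> e)\<^sup>2)"
proof -
  have "exp t * (1 + f v \<bullet> v - t) =
      exp t * (1 - t) * (\<Sum>e\<in>E. (v \<bullet> e)\<^sup>2) + exp t * (\<Sum>e\<in>E. (f e \<bullet> e) * (v \<bullet> e)\<^sup>2)"
    using eigenbasis_parseval_sq[OF E, of v] eigenbasis_quadratic_form[OF f E, of v] v
    by (simp add: algebra_simps)
  also have "\<dots> = (\<Sum>e\<in>E. exp t * (1 - t) * (v \<bullet> e)\<^sup>2 + exp t * ((f e \<bullet> e) * (v \<bullet> e)\<^sup>2))"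
    by (simp only: sum_distrib_left sum.distrib)
  also have "\<dots> \<le> (\<Sum>e\<in>E. exp (f e \<bullet> e) * (v \<bullet> e)\<^sup>2)"
  proof (rule sum_mono)
    fix e
    have "exp t * (1 + (f e \<bullet> e - t)) \<le> exp t * exp (f e \<bullet> e - t)"
      by (intro mult_left_mono exp_ge_add_one_self) auto
    also have "\<dots> = exp (f e \<bullet> e)" by (simp add: exp_diff)
    finally have "exp t * (1 + (f e \<bullet> e - t)) * (v \<bullet> e)\<^sup>2 \<le> exp (f e \<bullet> e) * (v \<bullet> e)\<^sup>2"
      by (rule mult_right_mono) simp
    then show "exp t * (1 - t) * (v \<bullet> e)\<^sup>2 + exp t * ((f e \<bullet> e) * (v \<bullet> e)\<^sup>2)
        \<le> exp (f e \<bullet> e) * (v \<bullet> e)\<^sup>2"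
      by (simp add: distrib_left distrib_right left_diff_distrib right_diff_distrib mult.assoc)
  qed
  finally show ?thesis .
qed

text \<open>Klein's inequality for the exponential: the trace exponential lies above its tangent at \<open>f\<close>. It
holds because the diagonal of \<open>e\<^sup>g\<close> in the eigenbasis of \<open>f\<close> obeys the tangent line
inequality entry by entry.\<close>

lemma trace_exp_klein:
  assumes g: "self_adjoint g" and D: "eigenbasis g D" and E: "eigenbasis f E"
  shows "(\<Sum>e\<in>E. exp (f e \<bullet> e) * (1 + (g e - f e) \<bullet> e)) \<le> (\<Sum>d\<in>D. exp (g d \<bullet> d))"
proof -
  have "(\<Sum>e\<in>E. exp (f e \<bullet> e) * (1 + (g e - f e) \<bullet> e)) \<le> (\<Sum>e\<in>E. \<Sum>d\<in>D. exp (g d \<bullet> d) * (e \<bullet> d)\<^sup>2)"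
  proof (rule sum_mono)
    fix e assume "e \<in> E"
    with exp_quadratic_form_tangent[OF g D eigenbasis_norm[OF E this], of "f e \<bullet> e"]
    show "exp (f e \<bullet> e) * (1 + (g e - f e) \<bullet> e) \<le> (\<Sum>d\<in>D. exp (g d \<bullet> d) * (e \<bullet> d)\<^sup>2)"
      by (simp add: inner_diff_left algebra_simps)
  qed
  also have "\<dots> = (\<Sum>d\<in>D. exp (g d \<bullet> d) * (\<Sum>e\<in>E. (d \<bullet> e)\<^sup>2))"
    by (subst sum.swap) (simp add: sum_distrib_left inner_commute)
  also have "\<dots> = (\<Sum>d\<in>D. exp (g d \<bullet> d))"
    using eigenbasis_parseval_sq[OF E] eigenbasis_norm[OF D] by simp
  finally show ?thesis .
qed

section \<open>Rank-one perturbations\<close>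

text \<open>Twice the difference of the two sides is the weighted double sum of the products
\<open>(f i - f j) * (g i - g j)\<close>.\<close>

lemma chebyshev_weighted_sum:
  fixes w f g :: "'a \<Rightarrow> real"
  assumes w: "\<And>i. i \<in> A \<Longrightarrow> 0 \<le> w i" and sum1: "sum w A = 1"
    and mono: "\<And>i j. i \<in> A \<Longrightarrow> j \<in> A \<Longrightarrow> 0 \<le> (f i - f j) * (g i - g j)"
  shows "(\<Sum>i\<in>A. f i * w i) * (\<Sum>i\<in>A. g i * w i) \<le> (\<Sum>i\<in>A. f i * g i * w i)"
proof -
  have "0 \<le> (\<Sum>i\<in>A. \<Sum>j\<in>A. w i * w j * ((f i - f j) * (g i - g j)))"
    by (intro sum_nonneg) (rule mult_nonneg_nonneg[OF mult_nonneg_nonneg]; simp add: w mono)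
  also have "\<dots> = (\<Sum>i\<in>A. \<Sum>j\<in>A. (f i * g i * w i) * w j) + (\<Sum>i\<in>A. \<Sum>j\<in>A. w i * (f j * g j * w j))
       - (\<Sum>i\<in>A. \<Sum>j\<in>A. (f i * w i) * (g j * w j)) - (\<Sum>i\<in>A. \<Sum>j\<in>A. (g i * w i) * (f j * w j))"
    unfolding sum.distrib[symmetric] sum_subtractf[symmetric]
    by (intro sum.cong refl) (simp add: algebra_simps)
  also have "\<dots> = 2 * (\<Sum>i\<in>A. f i * g i * w i) - 2 * ((\<Sum>i\<in>A. f i * w i) * (\<Sum>i\<in>A. g i * w i))"
    unfolding sum_product[symmetric] sum1 by simp
  finally show ?thesis by simp
qed

definition rank_one_update :: "real \<Rightarrow> 'a::euclidean_space \<Rightarrow> ('a \<Rightarrow> 'a) \<Rightarrow> 'a \<Rightarrow> 'a" where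
  "rank_one_update x u f = (\<lambda>v. f v + (x * (u \<bullet> v)) *\<^sub>R u)"

lemma self_adjoint_rank_one_update:
  "self_adjoint f \<Longrightarrow> self_adjoint (rank_one_update x u f)"
  unfolding rank_one_update_def by (intro self_adjoint_add self_adjoint_rank_one)

text \<open>In operator notation, with \<open>T = f + x u u\<^sup>T\<close>:
\<open>(f\<^sup>k T\<^sup>l u, u) \<le> (f\<^sup>k (f + x)\<^sup>l u, u)\<close>. One factor \<open>T\<close> on the left splits into
\<open>f\<close>, which raises \<open>k\<close>, and \<open>x u u\<^sup>T\<close>, which splits off the product of
\<open>(f\<^sup>k u, u)\<close> and \<open>(T\<^sup>l u, u)\<close>. Chebyshev's inequality merges that product into a single
form, since \<open>\<lambda>\<^sup>k\<close> and \<open>(\<lambda> + x)\<^sup>l\<close> both increase in \<open>\<lambda> \<ge> 0\<close>. The power \<open>k\<close> must be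
general because the induction hypothesis is used at \<open>k + 1\<close> and at \<open>0\<close>.\<close>

lemma power_form_bound:
  assumes f: "self_adjoint f" and E: "eigenbasis f E" and pos: "\<And>e. e \<in> E \<Longrightarrow> 0 \<le> f e \<bullet> e"
    and x: "0 \<le> x" and u: "norm u = 1"
  shows "(\<Sum>e\<in>E. (f e \<bullet> e) ^ k * (u \<bullet> e) * ((rank_one_update x u f ^^ l) u \<bullet> e))
    \<le> (\<Sum>e\<in>E. (f e \<bullet> e) ^ k * (f e \<bullet> e + x) ^ l * (u \<bullet> e)\<^sup>2)"
proof (induction l arbitrary: k)
  case 0
  show ?case by (simp add: power2_eq_square algebra_simps)
next
  case (Suc l)
  define w where "w = (rank_one_update x u f ^^ l) u"
  define a where "a k = (\<Sum>e\<in>E. (f e \<bullet> e) ^ k * (u \<bullet> e)\<^sup>2)" for k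
  define c where "c k = (\<Sum>e\<in>E. (f e \<bullet> e) ^ k * (f e \<bullet> e + x) ^ l * (u \<bullet> e)\<^sup>2)" for k
  have a0: "0 \<le> a k" unfolding a_def using pos by (intro sum_nonneg) auto
  have step: "(rank_one_update x u f ^^ Suc l) u \<bullet> e = (f e \<bullet> e) * (w \<bullet> e) + x * (u \<bullet> w) * (u \<bullet> e)"
    if "e \<in> E" for e
    using eigenbasis_inner[OF f E that, of w] by (simp add: w_def rank_one_update_def inner_add_left)
  have "(\<Sum>e\<in>E. (f e \<bullet> e) ^ k * (u \<bullet> e) * ((rank_one_update x u f ^^ Suc l) u \<bullet> e))
      = (\<Sum>e\<in>E. (f e \<bullet> e) ^ k * (u \<bullet> e) * ((f e \<bullet> e) * (w \<bullet> e) + x * (u \<bullet> w) * (u \<bullet> e)))"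
    by (intro sum.cong refl) (simp only: step)
  also have "\<dots> = (\<Sum>e\<in>E. (f e \<bullet> e) ^ Suc k * (u \<bullet> e) * (w \<bullet> e)) + x * (u \<bullet> w) * a k"
    unfolding a_def sum_distrib_left sum.distrib[symmetric]
    by (intro sum.cong refl) (simp add: algebra_simps power2_eq_square)
  also have "\<dots> \<le> c (Suc k) + x * c 0 * a k"
  proof (intro add_mono mult_right_mono mult_left_mono a0 x)
    show "(\<Sum>e\<in>E. (f e \<bullet> e) ^ Suc k * (u \<bullet> e) * (w \<bullet> e)) \<le> c (Suc k)"
      unfolding w_def c_def by (rule Suc.IH)
    show "u \<bullet> w \<le> c 0"
      using Suc.IH[of 0] eigenbasis_parseval[OF E, of u w] by (simp add: w_def c_def)
  qed
  also have "\<dots> = c (Suc k) + x * (a k * c 0)" by simp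
  also have "\<dots> \<le> c (Suc k) + x * c k"
  proof (intro add_left_mono mult_left_mono x)
    have "a k * (\<Sum>e\<in>E. (f e \<bullet> e + x) ^ l * (u \<bullet> e)\<^sup>2) \<le> c k"
      unfolding a_def c_def
    proof (rule chebyshev_weighted_sum)
      show "(\<Sum>e\<in>E. (u \<bullet> e)\<^sup>2) = 1" using eigenbasis_parseval_sq[OF E] u by simp
    next
      fix d e assume de: "d \<in> E" "e \<in> E"
      have *: "0 \<le> (s ^ k - t ^ k) * ((s + x) ^ l - (t + x) ^ l)" if "0 \<le> t" "t \<le> s" for s t :: real
        using that x by (intro mult_nonneg_nonneg) (auto intro!: power_mono)
      show "0 \<le> ((f d \<bullet> d) ^ k - (f e \<bullet> e) ^ k) * ((f d \<bullet> d + x) ^ l - (f e \<bullet> e + x) ^ l)"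
        using *[of "f e \<bullet> e" "f d \<bullet> d"] *[of "f d \<bullet> d" "f e \<bullet> e"] pos de
        by (cases "f e \<bullet> e \<le> f d \<bullet> d") (auto simp: algebra_simps)
    qed auto
    then show "a k * c 0 \<le> c k" by (simp add: c_def)
  qed
  also have "\<dots> = (\<Sum>e\<in>E. (f e \<bullet> e) ^ k * (f e \<bullet> e + x) ^ Suc l * (u \<bullet> e)\<^sup>2)"
    unfolding c_def sum_distrib_left sum.distrib[symmetric]
    by (intro sum.cong refl) (simp add: algebra_simps)
  finally show ?case .
qed

text \<open>In operator notation:
\<open>tr (f\<^sup>k T\<^sup>l) \<le> tr (f\<^sup>k f\<^sup>l) + (f\<^sup>k ((f + x)\<^sup>l - f\<^sup>l) u, u)\<close>. Expanding one factor
\<open>T\<close> leaves \<open>x (f\<^sup>k T\<^sup>l u, u)\<close>, which is bounded by the previous lemma, and the increments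
telescope.\<close>

lemma power_trace_bound:
  assumes f: "self_adjoint f" and E: "eigenbasis f E" and pos: "\<And>e. e \<in> E \<Longrightarrow> 0 \<le> f e \<bullet> e"
    and x: "0 \<le> x" and u: "norm u = 1"
    and T: "self_adjoint (rank_one_update x u f)"
  shows "(\<Sum>e\<in>E. (f e \<bullet> e) ^ k * ((rank_one_update x u f ^^ l) e \<bullet> e))
    \<le> (\<Sum>e\<in>E. (f e \<bullet> e) ^ k * ((f e \<bullet> e) ^ l + ((f e \<bullet> e + x) ^ l - (f e \<bullet> e) ^ l) * (u \<bullet> e)\<^sup>2))"
proof (induction l arbitrary: k)
  case 0
  show ?case using eigenbasis_norm[OF E] by (simp add: dot_square_norm)
next
  case (Suc l)
  let ?T = "rank_one_update x u f"
  have adj: "(?T ^^ l) v \<bullet> w = v \<bullet> (?T ^^ l) w" for v w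
  proof (induction l arbitrary: w)
    case (Suc l)
    have "(?T ^^ Suc l) v \<bullet> w = (?T ^^ l) v \<bullet> ?T w" by (simp add: self_adjointD(1)[OF T])
    also have "\<dots> = v \<bullet> (?T ^^ Suc l) w" by (simp only: Suc.IH funpow_Suc_right o_apply)
    finally show ?case .
  qed simp
  have step: "(?T ^^ Suc l) e \<bullet> e = (f e \<bullet> e) * ((?T ^^ l) e \<bullet> e) + x * (u \<bullet> e) * ((?T ^^ l) u \<bullet> e)"
    if "e \<in> E" for e
    using eigenbasis_inner[OF f E that, of "(?T ^^ l) e"] adj[of u e]
    by (simp add: rank_one_update_def inner_add_left)
  have "(\<Sum>e\<in>E. (f e \<bullet> e) ^ k * ((?T ^^ Suc l) e \<bullet> e))
     = (\<Sum>e\<in>E. (f e \<bullet> e) ^ k * ((f e \<bullet> e) * ((?T ^^ l) e \<bullet> e) + x * (u \<bullet> e) * ((?T ^^ l) u \<bullet> e)))"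
    by (intro sum.cong refl) (simp only: step)
  also have "\<dots> = (\<Sum>e\<in>E. (f e \<bullet> e) ^ Suc k * ((?T ^^ l) e \<bullet> e))
      + x * (\<Sum>e\<in>E. (f e \<bullet> e) ^ k * (u \<bullet> e) * ((?T ^^ l) u \<bullet> e))"
    unfolding sum_distrib_left sum.distrib[symmetric]
    by (intro sum.cong refl) (simp add: algebra_simps)
  also have "\<dots> \<le> (\<Sum>e\<in>E. (f e \<bullet> e) ^ Suc k * ((f e \<bullet> e) ^ l + ((f e \<bullet> e + x) ^ l - (f e \<bullet> e) ^ l) * (u \<bullet> e)\<^sup>2))
      + x * (\<Sum>e\<in>E. (f e \<bullet> e) ^ k * (f e \<bullet> e + x) ^ l * (u \<bullet> e)\<^sup>2)"
    by (intro add_mono mult_left_mono Suc.IH power_form_bound[OF f E pos x u] x)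
  also have "\<dots> = (\<Sum>e\<in>E. (f e \<bullet> e) ^ k * ((f e \<bullet> e) ^ Suc l + ((f e \<bullet> e + x) ^ Suc l - (f e \<bullet> e) ^ Suc l) * (u \<bullet> e)\<^sup>2))"
    unfolding sum_distrib_left sum.distrib[symmetric]
    by (intro sum.cong refl) (simp add: algebra_simps)
  finally show ?case .
qed

lemma eigenbasis_power:
  assumes T: "self_adjoint T" and D: "eigenbasis T D" and d: "d \<in> D"
  shows "(T ^^ l) v \<bullet> d = (T d \<bullet> d) ^ l * (v \<bullet> d)"
proof (induction l)
  case (Suc l)
  then show ?case using eigenbasis_inner[OF T D d, of "(T ^^ l) v"] by simp
qed simp

text \<open>Passage from powers to exponentials through the power series. The right side carries two families of
exponents because a rank-one update involves both \<open>\<lambda>\<close> and \<open>\<lambda> + x\<close>.\<close>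

lemma exp_sum_le_from_powers:
  fixes a \<mu> :: "'i \<Rightarrow> real" and b \<nu> c \<rho> :: "'j \<Rightarrow> real"
  assumes le: "\<And>l. (\<Sum>i\<in>I. a i * \<mu> i ^ l) \<le> (\<Sum>j\<in>J. b j * \<nu> j ^ l + c j * \<rho> j ^ l)"
  shows "(\<Sum>i\<in>I. a i * exp (\<mu> i)) \<le> (\<Sum>j\<in>J. b j * exp (\<nu> j) + c j * exp (\<rho> j))"
proof (rule sums_le)
  show "(\<lambda>l. \<Sum>i\<in>I. a i * (\<mu> i ^ l /\<^sub>R fact l)) sums (\<Sum>i\<in>I. a i * exp (\<mu> i))"
    by (rule sums_sum, rule sums_mult, rule exp_converges)
  show "(\<lambda>l. \<Sum>j\<in>J. b j * (\<nu> j ^ l /\<^sub>R fact l) + c j * (\<rho> j ^ l /\<^sub>R fact l))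
      sums (\<Sum>j\<in>J. b j * exp (\<nu> j) + c j * exp (\<rho> j))"
    by (rule sums_sum, rule sums_add; rule sums_mult, rule exp_converges)
  fix l
  have "inverse (fact l) * (\<Sum>i\<in>I. a i * \<mu> i ^ l) \<le> inverse (fact l) * (\<Sum>j\<in>J. b j * \<nu> j ^ l + c j * \<rho> j ^ l)"
    by (rule mult_left_mono[OF le]) simp
  then show "(\<Sum>i\<in>I. a i * (\<mu> i ^ l /\<^sub>R fact l))
      \<le> (\<Sum>j\<in>J. b j * (\<nu> j ^ l /\<^sub>R fact l) + c j * (\<rho> j ^ l /\<^sub>R fact l))"
    by (simp only: sum_distrib_left real_scaleR_def distrib_left mult.left_commute[of _ "inverse (fact l)"])
qed

lemma trace_power_eigenvalues:
  assumes T: "self_adjoint T" and D: "eigenbasis T D" and E: "eigenbasis f E"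
  shows "(\<Sum>e\<in>E. (T ^^ l) e \<bullet> e) = (\<Sum>d\<in>D. (T d \<bullet> d) ^ l)"
proof -
  have "(\<Sum>e\<in>E. (T ^^ l) e \<bullet> e) = (\<Sum>e\<in>E. \<Sum>d\<in>D. ((T ^^ l) e \<bullet> d) * (e \<bullet> d))"
    by (simp only: eigenbasis_parseval[OF D])
  also have "\<dots> = (\<Sum>e\<in>E. \<Sum>d\<in>D. (T d \<bullet> d) ^ l * (e \<bullet> d)\<^sup>2)"
    by (intro sum.cong refl) (simp only: eigenbasis_power[OF T D] power2_eq_square mult.assoc)
  also have "\<dots> = (\<Sum>d\<in>D. (T d \<bullet> d) ^ l * (\<Sum>e\<in>E. (d \<bullet> e)\<^sup>2))"
    by (subst sum.swap) (simp add: sum_distrib_left inner_commute)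
  also have "\<dots> = (\<Sum>d\<in>D. (T d \<bullet> d) ^ l)"
    using eigenbasis_parseval_sq[OF E] eigenbasis_norm[OF D] by simp
  finally show ?thesis .
qed

text \<open>The bounds on powers, at \<open>k = 0\<close>, summed over the exponential series: a positive update by
\<open>x u u\<^sup>T\<close> raises the trace of the exponential by at most \<open>(e\<^sup>x - 1) (e\<^sup>f u, u)\<close> and
multiplies the form of the exponential at \<open>u\<close> by at most \<open>e\<^sup>x\<close>.\<close>

lemma exp_rank_one_bounds_psd:
  assumes f: "self_adjoint f" and E: "eigenbasis f E" and pos: "\<And>e. e \<in> E \<Longrightarrow> 0 \<le> f e \<bullet> e"
    and x: "0 \<le> x" and u: "norm u = 1"
    and D: "eigenbasis (rank_one_update x u f) D"
  shows "(\<Sum>d\<in>D. exp (rank_one_update x u f d \<bullet> d))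
           \<le> (\<Sum>e\<in>E. exp (f e \<bullet> e) * (1 + (exp x - 1) * (u \<bullet> e)\<^sup>2))"
    and "(\<Sum>d\<in>D. exp (rank_one_update x u f d \<bullet> d) * (u \<bullet> d)\<^sup>2)
           \<le> (\<Sum>e\<in>E. exp (f e \<bullet> e) * (exp x * (u \<bullet> e)\<^sup>2))"
proof -
  let ?T = "rank_one_update x u f"
  have T: "self_adjoint ?T" by (rule self_adjoint_rank_one_update[OF f])
  have "(\<Sum>d\<in>D. 1 * exp (?T d \<bullet> d))
      \<le> (\<Sum>e\<in>E. (1 - (u \<bullet> e)\<^sup>2) * exp (f e \<bullet> e) + (u \<bullet> e)\<^sup>2 * exp (f e \<bullet> e + x))"
  proof (rule exp_sum_le_from_powers)
    fix l
    have "(\<Sum>d\<in>D. 1 * (?T d \<bullet> d) ^ l) = (\<Sum>e\<in>E. (f e \<bullet> e) ^ 0 * ((?T ^^ l) e \<bullet> e))"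
      by (simp add: trace_power_eigenvalues[OF T D E])
    also have "\<dots> \<le> (\<Sum>e\<in>E. (f e \<bullet> e) ^ 0 * ((f e \<bullet> e) ^ l + ((f e \<bullet> e + x) ^ l - (f e \<bullet> e) ^ l) * (u \<bullet> e)\<^sup>2))"
      by (rule power_trace_bound[OF f E pos x u T])
    also have "\<dots> = (\<Sum>e\<in>E. (1 - (u \<bullet> e)\<^sup>2) * (f e \<bullet> e) ^ l + (u \<bullet> e)\<^sup>2 * (f e \<bullet> e + x) ^ l)"
      by (intro sum.cong refl) (simp add: algebra_simps)
    finally show "(\<Sum>d\<in>D. 1 * (?T d \<bullet> d) ^ l)
        \<le> (\<Sum>e\<in>E. (1 - (u \<bullet> e)\<^sup>2) * (f e \<bullet> e) ^ l + (u \<bullet> e)\<^sup>2 * (f e \<bullet> e + x) ^ l)" .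
  qed
  also have "\<dots> = (\<Sum>e\<in>E. exp (f e \<bullet> e) * (1 + (exp x - 1) * (u \<bullet> e)\<^sup>2))"
    by (intro sum.cong refl) (simp add: exp_add algebra_simps)
  finally show "(\<Sum>d\<in>D. exp (?T d \<bullet> d)) \<le> (\<Sum>e\<in>E. exp (f e \<bullet> e) * (1 + (exp x - 1) * (u \<bullet> e)\<^sup>2))"
    by simp
  have "(\<Sum>d\<in>D. (u \<bullet> d)\<^sup>2 * exp (?T d \<bullet> d))
      \<le> (\<Sum>e\<in>E. (u \<bullet> e)\<^sup>2 * exp (f e \<bullet> e + x) + 0 * exp (f e \<bullet> e))"
  proof (rule exp_sum_le_from_powers)
    fix l
    have "(\<Sum>d\<in>D. (u \<bullet> d)\<^sup>2 * (?T d \<bullet> d) ^ l) = (\<Sum>d\<in>D. (u \<bullet> d) * ((?T ^^ l) u \<bullet> d))"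
      by (intro sum.cong refl) (simp add: eigenbasis_power[OF T D] power2_eq_square)
    also have "\<dots> = (\<Sum>e\<in>E. (f e \<bullet> e) ^ 0 * (u \<bullet> e) * ((?T ^^ l) u \<bullet> e))"
      by (simp add: eigenbasis_parseval[OF D] eigenbasis_parseval[OF E])
    also have "\<dots> \<le> (\<Sum>e\<in>E. (f e \<bullet> e) ^ 0 * (f e \<bullet> e + x) ^ l * (u \<bullet> e)\<^sup>2)"
      by (rule power_form_bound[OF f E pos x u])
    finally show "(\<Sum>d\<in>D. (u \<bullet> d)\<^sup>2 * (?T d \<bullet> d) ^ l)
        \<le> (\<Sum>e\<in>E. (u \<bullet> e)\<^sup>2 * (f e \<bullet> e + x) ^ l + 0 * (f e \<bullet> e) ^ l)"
      by (simp add: mult.commute)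
  qed
  then show "(\<Sum>d\<in>D. exp (?T d \<bullet> d) * (u \<bullet> d)\<^sup>2) \<le> (\<Sum>e\<in>E. exp (f e \<bullet> e) * (exp x * (u \<bullet> e)\<^sup>2))"
    by (simp add: exp_add mult_ac)
qed

text \<open>The general case reduces to the positive semidefinite one by a shift.\<close>

lemma exp_rank_one_bounds:
  assumes f: "self_adjoint f" and E: "eigenbasis f E" and x: "0 \<le> x" and u: "norm u = 1"
    and D: "eigenbasis (rank_one_update x u f) D"
  shows "(\<Sum>d\<in>D. exp (rank_one_update x u f d \<bullet> d))
           \<le> (\<Sum>e\<in>E. exp (f e \<bullet> e) * (1 + (exp x - 1) * (u \<bullet> e)\<^sup>2))"
    and "(\<Sum>d\<in>D. exp (rank_one_update x u f d \<bullet> d) * (u \<bullet> d)\<^sup>2)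
           \<le> exp x * (\<Sum>e\<in>E. exp (f e \<bullet> e) * (u \<bullet> e)\<^sup>2)"
proof -
  \<comment> \<open>Any shift that makes all eigenvalues nonnegative will do.\<close>
  define c where "c = (\<Sum>e\<in>E. \<bar>f e \<bullet> e\<bar>)"
  define g where "g = (\<lambda>v. f v + c *\<^sub>R v)"
  let ?T = "rank_one_update x u f"
  have g: "self_adjoint g" unfolding g_def by (intro self_adjoint_add self_adjoint_scale self_adjoint_id f)
  have gE: "eigenbasis g E" unfolding g_def by (rule eigenbasis_shift[OF E])
  have ge: "g e \<bullet> e = f e \<bullet> e + c" if "e \<in> E" for e
    unfolding g_def by (rule shifted_eigenvalue[OF E that])
  have pos: "0 \<le> g e \<bullet> e" if "e \<in> E" for e
  proof -
    have "\<bar>f e \<bullet> e\<bar> \<le> c"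
      unfolding c_def using that by (intro member_le_sum eigenbasis_finite[OF E]) auto
    then show ?thesis using ge[OF that] by linarith
  qed
  have Tg: "rank_one_update x u g = (\<lambda>v. ?T v + c *\<^sub>R v)"
    unfolding g_def rank_one_update_def by (simp add: add_ac)
  have gD: "eigenbasis (rank_one_update x u g) D" unfolding Tg by (rule eigenbasis_shift[OF D])
  have Td: "rank_one_update x u g d \<bullet> d = ?T d \<bullet> d + c" if "d \<in> D" for d
    unfolding Tg by (rule shifted_eigenvalue[OF D that])
  have "exp c * (\<Sum>d\<in>D. exp (?T d \<bullet> d)) \<le> exp c * (\<Sum>e\<in>E. exp (f e \<bullet> e) * (1 + (exp x - 1) * (u \<bullet> e)\<^sup>2))"
    using exp_rank_one_bounds_psd(1)[OF g gE pos x u gD]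
    by (simp add: ge Td exp_add sum_distrib_left mult_ac cong: sum.cong)
  then show "(\<Sum>d\<in>D. exp (?T d \<bullet> d)) \<le> (\<Sum>e\<in>E. exp (f e \<bullet> e) * (1 + (exp x - 1) * (u \<bullet> e)\<^sup>2))"
    by simp
  have "exp c * (\<Sum>d\<in>D. exp (?T d \<bullet> d) * (u \<bullet> d)\<^sup>2) \<le> exp c * (exp x * (\<Sum>e\<in>E. exp (f e \<bullet> e) * (u \<bullet> e)\<^sup>2))"
    using exp_rank_one_bounds_psd(2)[OF g gE pos x u gD]
    by (simp add: ge Td exp_add sum_distrib_left mult_ac cong: sum.cong)
  then show "(\<Sum>d\<in>D. exp (?T d \<bullet> d) * (u \<bullet> d)\<^sup>2) \<le> exp x * (\<Sum>e\<in>E. exp (f e \<bullet> e) * (u \<bullet> e)\<^sup>2)"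
    by simp
qed

text \<open>The coefficient of \<open>(e\<^sup>f u, u)\<close> in the bound for the trace exponential of \<open>f + x u u\<^sup>T\<close>. For
negative \<open>x\<close> it is the slightly weaker \<open>x e\<^sup>x\<close> in place of \<open>e\<^sup>x - 1\<close>, which is what
convexity yields; both differ from \<open>x\<close> by a term of order \<open>x\<^sup>2\<close>.\<close>

definition exp_slope :: "real \<Rightarrow> real" where
  "exp_slope x = (if 0 \<le> x then exp x - 1 else x * exp x)"

text \<open>For negative \<open>x\<close>, view \<open>f\<close> as the update of \<open>g = f + x u u\<^sup>T\<close> by the positive amount
\<open>y = - x\<close>. Klein's inequality at \<open>g\<close> bounds the decrease of the trace below by
\<open>y (e\<^sup>g u, u)\<close>, and the second rank-one bound compares this form with \<open>(e\<^sup>f u, u)\<close> at the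
cost of a factor \<open>e\<^sup>-\<^sup>y\<close>.\<close>

lemma trace_exp_rank_one_update:
  assumes f: "self_adjoint f" and E: "eigenbasis f E" and u: "norm u = 1"
    and D: "eigenbasis (rank_one_update x u f) D"
  shows "(\<Sum>d\<in>D. exp (rank_one_update x u f d \<bullet> d))
           \<le> (\<Sum>e\<in>E. exp (f e \<bullet> e) * (1 + exp_slope x * (u \<bullet> e)\<^sup>2))"
proof (cases "0 \<le> x")
  case True
  then show ?thesis using exp_rank_one_bounds(1)[OF f E True u D] by (simp add: exp_slope_def)
next
  case False
  define y where "y = - x"
  define g where "g = rank_one_update x u f"
  have y: "0 \<le> y" using False by (simp add: y_def)
  have fg: "f = rank_one_update y u g"
    by (simp add: rank_one_update_def g_def y_def)
  have g: "self_adjoint g" unfolding g_def by (rule self_adjoint_rank_one_update[OF f])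
  have D: "eigenbasis g D" using D by (simp add: g_def)
  have 1: "(\<Sum>e\<in>E. exp (f e \<bullet> e) * (u \<bullet> e)\<^sup>2) \<le> exp y * (\<Sum>d\<in>D. exp (g d \<bullet> d) * (u \<bullet> d)\<^sup>2)"
    using exp_rank_one_bounds(2)[OF g D y u, folded fg, OF E] .
  have "(f d - g d) \<bullet> d = y * (u \<bullet> d)\<^sup>2" for d
    by (subst fg) (simp add: rank_one_update_def power2_eq_square)
  then have "(\<Sum>d\<in>D. exp (g d \<bullet> d) * (1 + y * (u \<bullet> d)\<^sup>2)) \<le> (\<Sum>e\<in>E. exp (f e \<bullet> e))"
    using trace_exp_klein[OF f E D] by simp
  then have 2: "(\<Sum>d\<in>D. exp (g d \<bullet> d)) + y * (\<Sum>d\<in>D. exp (g d \<bullet> d) * (u \<bullet> d)\<^sup>2) \<le> (\<Sum>e\<in>E. exp (f e \<bullet> e))"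
    by (simp add: distrib_left sum.distrib sum_distrib_left mult_ac)
  have "y * exp (-y) * (\<Sum>e\<in>E. exp (f e \<bullet> e) * (u \<bullet> e)\<^sup>2)
      \<le> y * exp (-y) * (exp y * (\<Sum>d\<in>D. exp (g d \<bullet> d) * (u \<bullet> d)\<^sup>2))"
    using y by (intro mult_left_mono 1) auto
  also have "\<dots> = y * (\<Sum>d\<in>D. exp (g d \<bullet> d) * (u \<bullet> d)\<^sup>2)" by (simp add: exp_minus)
  finally have "(\<Sum>d\<in>D. exp (g d \<bullet> d))
      \<le> (\<Sum>e\<in>E. exp (f e \<bullet> e)) - y * exp (-y) * (\<Sum>e\<in>E. exp (f e \<bullet> e) * (u \<bullet> e)\<^sup>2)"
    using 2 by linarith
  also have "\<dots> = (\<Sum>e\<in>E. exp (f e \<bullet> e) * (1 + exp_slope x * (u \<bullet> e)\<^sup>2))"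
    using False
    by (simp add: y_def exp_slope_def distrib_left sum.distrib sum_distrib_left mult_ac sum_negf)
  finally show ?thesis by (simp add: g_def)
qed

section \<open>The trace exponential of a sum of independent rank-one maps\<close>

definition spectral_basis :: "('a::euclidean_space \<Rightarrow> 'a) \<Rightarrow> 'a set" where
  "spectral_basis f = (SOME E. eigenbasis f E)"

definition trace_exp :: "('a::euclidean_space \<Rightarrow> 'a) \<Rightarrow> real" where
  "trace_exp f = (\<Sum>e\<in>spectral_basis f. exp (f e \<bullet> e))"

lemma spectral_basis: "self_adjoint f \<Longrightarrow> eigenbasis f (spectral_basis f)"
  unfolding spectral_basis_def by (rule someI_ex) (rule eigenbasis_exists)

lemma trace_exp_pos: "0 \<le> trace_exp f"
  unfolding trace_exp_def by (intro sum_nonneg) auto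

lemma trace_exp_zero: "trace_exp (\<lambda>v::'a::euclidean_space. 0) = DIM('a)"
  using eigenbasis_card[OF spectral_basis[OF self_adjoint_zero]] by (simp add: trace_exp_def)

lemma trace_exp_ge_exp_form:
  assumes f: "self_adjoint f" and v: "norm v = 1"
  shows "exp (f v \<bullet> v) \<le> trace_exp f"
proof -
  note E = spectral_basis[OF f]
  have "exp (f v \<bullet> v) \<le> (\<Sum>e\<in>spectral_basis f. exp (f e \<bullet> e) * (v \<bullet> e)\<^sup>2)"
    using exp_quadratic_form_tangent[OF f E v, of "f v \<bullet> v"] by simp
  also have "\<dots> \<le> (\<Sum>e\<in>spectral_basis f. exp (f e \<bullet> e) * 1)"
  proof (intro sum_mono mult_left_mono)
    fix e assume "e \<in> spectral_basis f"
    then have "\<bar>v \<bullet> e\<bar> \<le> 1"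
      using Cauchy_Schwarz_ineq2[of v e] v eigenbasis_norm[OF E] by simp
    then show "(v \<bullet> e)\<^sup>2 \<le> 1" by (simp add: abs_square_le_1)
  qed auto
  finally show ?thesis by (simp add: trace_exp_def)
qed

text \<open>The rank-one bound is linear in \<open>u u\<^sup>T\<close>, so it can
be averaged, and the average is the tangent of the trace exponential at \<open>f\<close> in the direction of
the mean matrix. A zero row of a sampled matrix has no direction but also probability zero, which is why
unit length is asked only where \<open>p\<close> does not vanish.\<close>

lemma average_trace_exp_rank_one_update:
  fixes u :: "'k::finite \<Rightarrow> 'a::euclidean_space"
  assumes p: "\<And>k. 0 \<le> p k" "(\<Sum>k\<in>UNIV. p k) = 1" and u: "\<And>k. p k \<noteq> 0 \<Longrightarrow> norm (u k) = 1"
    and f: "self_adjoint f"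
  shows "(\<Sum>k\<in>UNIV. p k * trace_exp (rank_one_update x (u k) f))
    \<le> trace_exp (\<lambda>v. f v + exp_slope x *\<^sub>R (\<Sum>k\<in>UNIV. (p k * (u k \<bullet> v)) *\<^sub>R u k))"
proof -
  let ?g = "\<lambda>v. f v + exp_slope x *\<^sub>R (\<Sum>k\<in>UNIV. (p k * (u k \<bullet> v)) *\<^sub>R u k)"
  let ?E = "spectral_basis f"
  note E = spectral_basis[OF f]
  have g: "self_adjoint ?g"
    by (intro self_adjoint_add f self_adjoint_scale self_adjoint_sum self_adjoint_rank_one)
  have "(\<Sum>k\<in>UNIV. p k * trace_exp (rank_one_update x (u k) f))
      \<le> (\<Sum>k\<in>UNIV. p k * (\<Sum>e\<in>?E. exp (f e \<bullet> e) * (1 + exp_slope x * (u k \<bullet> e)\<^sup>2)))"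
  proof (rule sum_mono)
    fix k
    show "p k * trace_exp (rank_one_update x (u k) f)
        \<le> p k * (\<Sum>e\<in>?E. exp (f e \<bullet> e) * (1 + exp_slope x * (u k \<bullet> e)\<^sup>2))"
    proof (cases "p k = 0")
      case False
      show ?thesis unfolding trace_exp_def
        by (intro mult_left_mono p
            trace_exp_rank_one_update[OF f E u[OF False] spectral_basis[OF self_adjoint_rank_one_update[OF f]]])
    qed simp
  qed
  also have "\<dots> = (\<Sum>k\<in>UNIV. \<Sum>e\<in>?E. exp (f e \<bullet> e) * (p k + exp_slope x * (p k * (u k \<bullet> e)\<^sup>2)))"
    unfolding sum_distrib_left by (intro sum.cong refl) (simp add: algebra_simps)
  also have "\<dots> = (\<Sum>e\<in>?E. \<Sum>k\<in>UNIV. exp (f e \<bullet> e) * (p k + exp_slope x * (p k * (u k \<bullet> e)\<^sup>2)))"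
    by (rule sum.swap)
  also have "\<dots> = (\<Sum>e\<in>?E. exp (f e \<bullet> e) * (1 + (?g e - f e) \<bullet> e))"
    by (intro sum.cong refl)
       (simp add: sum_distrib_left[symmetric] sum.distrib p(2) inner_sum_left power2_eq_square mult.assoc)
  also have "\<dots> \<le> trace_exp ?g"
    unfolding trace_exp_def by (rule trace_exp_klein[OF g spectral_basis[OF g] E])
  finally show ?thesis .
qed

text \<open>Independent draws are exchanged one at a time: the sum over \<open>Pi\<^sub>E J\<close> with product weights is the
expectation over the draws indexed by \<open>J\<close>. The induction needs the bound for every self-adjoint
\<open>f\<close>, since the draw already made is absorbed into it.\<close>

lemma average_iterate:
  fixes p :: "'k::finite \<Rightarrow> real" and \<Phi> :: "('a::euclidean_space \<Rightarrow> 'a) \<Rightarrow> real"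
  assumes p: "\<And>k. 0 \<le> p k" and Y: "\<And>k. self_adjoint (Y k)" and Z: "self_adjoint Z"
    and step: "\<And>f. self_adjoint f \<Longrightarrow>
      (\<Sum>k\<in>UNIV. p k * \<Phi> (\<lambda>v. f v + Y k v)) \<le> \<Phi> (\<lambda>v. f v + Z v)"
  shows "finite J \<Longrightarrow> self_adjoint f \<Longrightarrow>
    (\<Sum>i\<in>Pi\<^sub>E J (\<lambda>_. UNIV). (\<Prod>t\<in>J. p (i t)) * \<Phi> (\<lambda>v. f v + (\<Sum>t\<in>J. Y (i t) v)))
      \<le> \<Phi> (\<lambda>v. f v + real (card J) *\<^sub>R Z v)"
proof (induction J arbitrary: f rule: finite_induct)
  case (insert t J)
  have "(\<Sum>i\<in>Pi\<^sub>E (insert t J) (\<lambda>_. UNIV). (\<Prod>t\<in>insert t J. p (i t)) *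
          \<Phi> (\<lambda>v. f v + (\<Sum>t\<in>insert t J. Y (i t) v)))
      = (\<Sum>(k, i)\<in>UNIV \<times> Pi\<^sub>E J (\<lambda>_. UNIV). (\<Prod>s\<in>insert t J. p ((i(t := k)) s)) *
          \<Phi> (\<lambda>v. f v + (\<Sum>s\<in>insert t J. Y ((i(t := k)) s) v)))"
    unfolding PiE_insert_eq using insert.hyps
    by (subst sum.reindex) (auto intro!: inj_combinator simp: case_prod_beta)
  also have "\<dots> = (\<Sum>(k, i)\<in>UNIV \<times> Pi\<^sub>E J (\<lambda>_. UNIV). p k * ((\<Prod>s\<in>J. p (i s)) *
          \<Phi> (\<lambda>v. (f v + Y k v) + (\<Sum>s\<in>J. Y (i s) v))))"
  proof (intro sum.cong refl, safe)
    fix k and i :: "_ \<Rightarrow> 'k"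
    have "(\<Prod>s\<in>J. p ((i(t := k)) s)) = (\<Prod>s\<in>J. p (i s))"
      using insert.hyps by (intro prod.cong) auto
    moreover have "(\<Sum>s\<in>J. Y ((i(t := k)) s) v) = (\<Sum>s\<in>J. Y (i s) v)" for v
      using insert.hyps by (intro sum.cong) auto
    ultimately show "(\<Prod>s\<in>insert t J. p ((i(t := k)) s)) * \<Phi> (\<lambda>v. f v + (\<Sum>s\<in>insert t J. Y ((i(t := k)) s) v))
      = p k * ((\<Prod>s\<in>J. p (i s)) * \<Phi> (\<lambda>v. (f v + Y k v) + (\<Sum>s\<in>J. Y (i s) v)))"
      using insert.hyps by (simp add: mult.assoc add.assoc)
  qed
  also have "\<dots> = (\<Sum>k\<in>UNIV. p k * (\<Sum>i\<in>Pi\<^sub>E J (\<lambda>_. UNIV). (\<Prod>s\<in>J. p (i s)) *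
          \<Phi> (\<lambda>v. (f v + Y k v) + (\<Sum>s\<in>J. Y (i s) v))))"
    by (simp add: sum.cartesian_product[symmetric] sum_distrib_left)
  also have "\<dots> \<le> (\<Sum>k\<in>UNIV. p k * \<Phi> (\<lambda>v. (f v + Y k v) + real (card J) *\<^sub>R Z v))"
    by (intro sum_mono mult_left_mono insert.IH p self_adjoint_add insert.prems Y)
  also have "\<dots> = (\<Sum>k\<in>UNIV. p k * \<Phi> (\<lambda>v. (f v + real (card J) *\<^sub>R Z v) + Y k v))"
    by (simp add: add_ac)
  also have "\<dots> \<le> \<Phi> (\<lambda>v. (f v + real (card J) *\<^sub>R Z v) + Z v)"
    by (intro step self_adjoint_add insert.prems self_adjoint_scale Z)
  also have "\<dots> = \<Phi> (\<lambda>v. f v + real (card (insert t J)) *\<^sub>R Z v)"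
    using insert.hyps by (simp add: algebra_simps)
  finally show ?case .
qed simp

lemma exp_slope_minus_le:
  assumes "\<bar>x\<bar> \<le> 1"
  shows "exp_slope x - x \<le> x\<^sup>2"
proof (cases "0 \<le> x")
  case True
  then show ?thesis using exp_bound[of x] assms by (simp add: exp_slope_def)
next
  case False
  have "x * (exp x - 1) \<le> x * x"
    using False exp_ge_add_one_self[of x] by (intro mult_left_mono_neg) linarith+
  then show ?thesis using False by (simp add: exp_slope_def power2_eq_square algebra_simps)
qed

text \<open>Tail bound for the quadratic forms of \<open>\<Sum>\<^sub>t u (i t) u (i t)\<^sup>T\<close>, uniform over the unit sphere.
The sign of \<open>x\<close> selects the upper or the lower tail. The left side is the probability of the
event, summed over all outcomes \<open>i\<close> of the draws.\<close>

theorem rank_one_chernoff: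
  fixes u :: "'k::finite \<Rightarrow> 'a::euclidean_space" and x :: real
  defines "q \<equiv> (\<lambda>v (i :: 's::finite \<Rightarrow> 'k). \<Sum>t\<in>UNIV. (u (i t) \<bullet> v)\<^sup>2)"
  assumes p: "\<And>k. 0 \<le> p k" "(\<Sum>k\<in>UNIV. p k) = 1" and u: "\<And>k. p k \<noteq> 0 \<Longrightarrow> norm (u k) = 1"
    and m: "\<And>v. norm v = 1 \<Longrightarrow> (\<Sum>k\<in>UNIV. p k * (u k \<bullet> v)\<^sup>2) \<le> \<Lambda>" and x: "\<bar>x\<bar> \<le> 1"
  shows "(\<Sum>i | \<exists>v. norm v = 1 \<and>
            x * (q v i - real CARD('s) * (\<Sum>k\<in>UNIV. p k * (u k \<bullet> v)\<^sup>2)) \<ge> real CARD('s) * \<tau>.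
            \<Prod>t\<in>UNIV. p (i t))
    \<le> DIM('a) * exp (- (real CARD('s) * (\<tau> - x\<^sup>2 * \<Lambda>)))"
    (is "(\<Sum>i\<in>?B. ?w i) \<le> _")
proof -
  define s where "s = real CARD('s)"
  define \<mu> where "\<mu> v = (\<Sum>k\<in>UNIV. p k * (u k \<bullet> v)\<^sup>2)" for v
  define Y where "Y k = (\<lambda>v. (x * (u k \<bullet> v)) *\<^sub>R u k)" for k
  define Z where "Z = (\<lambda>v. exp_slope x *\<^sub>R (\<Sum>k\<in>UNIV. (p k * (u k \<bullet> v)) *\<^sub>R u k))"
  \<comment> \<open>The compensated sum: it has trace exponential at most the dimension on average, as all copies
    of the compensator \<open>Z\<close> are used up by the draws.\<close>
  define H where "H i = (\<lambda>v. - s *\<^sub>R Z v + (\<Sum>t\<in>UNIV. Y (i t) v))" for i :: "'s \<Rightarrow> 'k"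
  have Y: "self_adjoint (Y k)" for k unfolding Y_def by (rule self_adjoint_rank_one)
  have Z: "self_adjoint Z" unfolding Z_def
    by (intro self_adjoint_scale self_adjoint_sum self_adjoint_rank_one)
  have sZ: "self_adjoint (\<lambda>v. - s *\<^sub>R Z v)" by (rule self_adjoint_scale[OF Z])
  have H: "self_adjoint (H i)" for i unfolding H_def by (intro self_adjoint_add sZ self_adjoint_sum Y)
  have step: "(\<Sum>k\<in>UNIV. p k * trace_exp (\<lambda>v. f v + Y k v)) \<le> trace_exp (\<lambda>v. f v + Z v)"
    if "self_adjoint f" for f
    using average_trace_exp_rank_one_update[where p = p and u = u and x = x, OF p u that]
    by (simp add: rank_one_update_def Y_def Z_def)
  have "(\<Sum>i\<in>Pi\<^sub>E UNIV (\<lambda>_. UNIV). ?w i * trace_exp (H i))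
      \<le> trace_exp (\<lambda>v. - s *\<^sub>R Z v + real CARD('s) *\<^sub>R Z v)"
    unfolding H_def by (rule average_iterate[of p Y Z trace_exp, OF p(1) Y Z step finite sZ])
  then have avg: "(\<Sum>i\<in>UNIV. ?w i * trace_exp (H i)) \<le> DIM('a)"
    by (simp add: s_def trace_exp_zero PiE_UNIV_domain)
  \<comment> \<open>On the event, the form of \<open>H i\<close> at the offending unit vector is large; replacing the
    compensator's coefficient \<open>exp_slope x\<close> by \<open>x\<close> costs at most \<open>x\<^sup>2 \<Lambda>\<close> per draw.\<close>
  have large: "exp (s * (\<tau> - x\<^sup>2 * \<Lambda>)) \<le> trace_exp (H i)" if "i \<in> ?B" for i
  proof -
    from that obtain v where v: "norm v = 1" "x * (q v i - s * \<mu> v) \<ge> s * \<tau>"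
      by (auto simp: s_def \<mu>_def)
    have "(exp_slope x - x) * \<mu> v \<le> x\<^sup>2 * \<Lambda>"
    proof -
      have \<mu>0: "0 \<le> \<mu> v" unfolding \<mu>_def by (intro sum_nonneg mult_nonneg_nonneg p) auto
      have "(exp_slope x - x) * \<mu> v \<le> x\<^sup>2 * \<mu> v"
        by (rule mult_right_mono[OF exp_slope_minus_le[OF x] \<mu>0])
      also have "\<dots> \<le> x\<^sup>2 * \<Lambda>" by (rule mult_left_mono) (use m[OF v(1)] in \<open>auto simp: \<mu>_def\<close>)
      finally show ?thesis .
    qed
    then have "s * ((exp_slope x - x) * \<mu> v) \<le> s * (x\<^sup>2 * \<Lambda>)"
      by (rule mult_left_mono) (simp add: s_def)
    moreover have "H i v \<bullet> v = x * (q v i - s * \<mu> v) - s * ((exp_slope x - x) * \<mu> v)"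
    proof -
      have "Z v \<bullet> v = exp_slope x * \<mu> v"
        by (simp add: Z_def \<mu>_def inner_sum_left power2_eq_square mult.assoc)
      moreover have "(\<Sum>t\<in>UNIV. Y (i t) v) \<bullet> v = x * q v i"
        by (simp add: Y_def q_def inner_sum_left sum_distrib_left power2_eq_square mult.assoc)
      ultimately show ?thesis by (simp add: H_def inner_add_left inner_diff_left algebra_simps)
    qed
    ultimately have "s * (\<tau> - x\<^sup>2 * \<Lambda>) \<le> H i v \<bullet> v"
      using v(2) by (simp add: right_diff_distrib)
    then have "exp (s * (\<tau> - x\<^sup>2 * \<Lambda>)) \<le> exp (H i v \<bullet> v)" by (simp only: exp_le_cancel_iff)
    then show ?thesis using trace_exp_ge_exp_form[OF H v(1)] by (rule order_trans)
  qed
  \<comment> \<open>Markov's inequality.\<close>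
  have "exp (s * (\<tau> - x\<^sup>2 * \<Lambda>)) * (\<Sum>i\<in>?B. ?w i) = (\<Sum>i\<in>?B. ?w i * exp (s * (\<tau> - x\<^sup>2 * \<Lambda>)))"
    by (simp add: sum_distrib_left mult.commute)
  also have "\<dots> \<le> (\<Sum>i\<in>?B. ?w i * trace_exp (H i))"
    by (intro sum_mono mult_left_mono large prod_nonneg) (auto simp: p)
  also have "\<dots> \<le> (\<Sum>i\<in>UNIV. ?w i * trace_exp (H i))"
    by (intro sum_mono2) (auto intro!: mult_nonneg_nonneg prod_nonneg trace_exp_pos p)
  finally have "exp (s * (\<tau> - x\<^sup>2 * \<Lambda>)) * (\<Sum>i\<in>?B. ?w i) \<le> DIM('a)" using avg by linarith
  then have "exp (- (s * (\<tau> - x\<^sup>2 * \<Lambda>))) * (exp (s * (\<tau> - x\<^sup>2 * \<Lambda>)) * (\<Sum>i\<in>?B. ?w i))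
      \<le> exp (- (s * (\<tau> - x\<^sup>2 * \<Lambda>))) * DIM('a)"
    by (rule mult_left_mono) simp
  then show ?thesis
    unfolding s_def mult.assoc[symmetric] exp_add[symmetric] by (simp add: mult.commute)
qed

section \<open>Forms of Gram matrices and the law of a row sample\<close>

lemma prob_iid_draws:
  fixes I :: "'s::finite \<Rightarrow> 'w \<Rightarrow> 'k::finite"
  assumes "iid_draws M p I"
  shows "\<P>(\<omega> in M. Q (\<lambda>t. I t \<omega>)) = (\<Sum>i | Q i. \<Prod>t\<in>UNIV. p (i t))"
proof -
  interpret prob_space M using assms by (simp add: iid_draws_def)
  have indep: "indep_vars (\<lambda>_. count_space UNIV) I UNIV" and p: "prob {\<omega> \<in> space M. I t \<omega> = k} = p k" for t k
    using assms by (auto simp: iid_draws_def)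
  have eq: "{\<omega> \<in> space M. I t \<omega> = k} = I t -` {k} \<inter> space M" for t k by auto
  have meas: "I t -` {k} \<inter> space M \<in> events" for t k
    using indep by (intro measurable_sets[of _ _ "count_space UNIV"]) (auto simp: indep_vars_def)
  let ?C = "\<lambda>i. \<Inter>t\<in>UNIV. I t -` {i t} \<inter> space M"
  have C: "?C i \<in> events" for i using meas by (intro sets.finite_INT) auto
  have "{\<omega> \<in> space M. Q (\<lambda>t. I t \<omega>)} = (\<Union>i\<in>{i. Q i}. ?C i)"
  proof (intro equalityI subsetI)
    fix \<omega> assume "\<omega> \<in> (\<Union>i\<in>{i. Q i}. ?C i)"
    then obtain i where "Q i" "\<omega> \<in> space M" "\<And>t. I t \<omega> = i t" by auto
    moreover from this have "(\<lambda>t. I t \<omega>) = i" by auto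
    ultimately show "\<omega> \<in> {\<omega> \<in> space M. Q (\<lambda>t. I t \<omega>)}" by simp
  qed auto
  moreover have "disjoint_family_on ?C {i. Q i}"
    unfolding disjoint_family_on_def by (auto simp: fun_eq_iff)
  ultimately have "prob {\<omega> \<in> space M. Q (\<lambda>t. I t \<omega>)} = (\<Sum>i | Q i. prob (?C i))"
    using C by (subst finite_measure_finite_Union[symmetric]) auto
  also have "\<dots> = (\<Sum>i | Q i. \<Prod>t\<in>UNIV. p (i t))"
    by (intro sum.cong refl, subst indep_varsD_finite[OF indep]) (auto simp: p[unfolded eq])
  finally show ?thesis .
qed

lemma gram_inner: "((transpose A ** A) *v x) \<bullet> y = (A *v x) \<bullet> (A *v y)" for A :: "real^'n^'m"
  by (simp add: matrix_vector_mul_assoc[symmetric] transpose_matrix_vector dot_lmul_matrix)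

lemma gram_form: "((transpose A ** A) *v x) \<bullet> x = (norm (A *v x))\<^sup>2" for A :: "real^'n^'m"
  by (simp add: gram_inner dot_square_norm)

lemma self_adjoint_gram: "self_adjoint ((*v) (transpose A ** A))" for A :: "real^'n^'m"
  unfolding self_adjoint_def by (metis gram_inner inner_commute matrix_vector_mul_linear)

text \<open>The number \<open>lambda_max B\<close> is a maximum over a set, so the set of eigenvalues has to be shown finite; it is
contained in the eigenvalues attached to an eigenbasis.\<close>

lemma quadratic_form_le_lambda_max:
  fixes B :: "real^'n^'n"
  assumes B: "self_adjoint ((*v) B)"
  shows "(B *v v) \<bullet> v \<le> lambda_max B * (norm v)\<^sup>2"
proof -
  obtain E where E: "eigenbasis ((*v) B) E" using eigenbasis_exists[OF B] ..
  have "eigenvalues B \<subseteq> (\<lambda>e. (B *v e) \<bullet> e) ` E"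
  proof
    fix l assume "l \<in> eigenvalues B"
    then obtain v where v: "v \<noteq> 0" "B *v v = l *\<^sub>R v" by (auto simp: eigenvalues_def)
    have "\<exists>e\<in>E. v \<bullet> e \<noteq> 0"
    proof (rule ccontr)
      assume "\<not> (\<exists>e\<in>E. v \<bullet> e \<noteq> 0)"
      then have "(\<Sum>e\<in>E. (v \<bullet> e)\<^sup>2) = 0" by simp
      then show False using eigenbasis_parseval_sq[OF E, of v] v(1) by simp
    qed
    then obtain e where e: "e \<in> E" "v \<bullet> e \<noteq> 0" by blast
    then have "l = (B *v e) \<bullet> e" using eigenbasis_inner[OF B E e(1), of v] v(2) by simp
    then show "l \<in> (\<lambda>e. (B *v e) \<bullet> e) ` E" using e by blast
  qed
  then have fin: "finite (eigenvalues B)" by (rule finite_surj[OF eigenbasis_finite[OF E]])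
  have "(B *v e) \<bullet> e \<le> lambda_max B" if "e \<in> E" for e
  proof -
    have "B *v e = ((B *v e) \<bullet> e) *\<^sub>R e" "norm e = 1" using E that unfolding eigenbasis_def by blast+
    moreover from this(2) have "e \<noteq> 0" by auto
    ultimately have "(B *v e) \<bullet> e \<in> eigenvalues B" unfolding eigenvalues_def by blast
    then show ?thesis unfolding lambda_max_def by (rule Max_ge[OF fin])
  qed
  then have "(\<Sum>e\<in>E. ((B *v e) \<bullet> e) * (v \<bullet> e)\<^sup>2) \<le> (\<Sum>e\<in>E. lambda_max B * (v \<bullet> e)\<^sup>2)"
    by (intro sum_mono mult_right_mono) auto
  then show ?thesis
    unfolding sum_distrib_left[symmetric] eigenbasis_parseval_sq[OF E]
    by (simp only: eigenbasis_quadratic_form[OF B E, symmetric])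
qed

text \<open>The squared Frobenius norm is the sum of the squared lengths of the images of the coordinate vectors.\<close>

lemma frobenius_sq_le:
  fixes A :: "real^'n^'m"
  assumes "\<And>v. norm v = 1 \<Longrightarrow> (norm (A *v v))\<^sup>2 \<le> c"
  shows "(frobenius_norm A)\<^sup>2 \<le> real CARD('n) * c"
proof -
  have "(frobenius_norm A)\<^sup>2 = (\<Sum>j\<in>UNIV. \<Sum>k\<in>UNIV. (A $ k $ j)\<^sup>2)"
    unfolding frobenius_norm_sq by (rule sum.swap)
  also have "\<dots> = (\<Sum>j\<in>UNIV. (norm (A *v axis j 1))\<^sup>2)"
    by (simp add: matrix_vector_mult_basis column_def norm_vec_def L2_set_def sum_nonneg)
  also have "\<dots> \<le> (\<Sum>j\<in>(UNIV::'n set). c)" by (intro sum_mono assms) simp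
  finally show ?thesis by simp
qed

lemma matrix_vector_component_row: "(A *v v) $ k = row k A \<bullet> v" for A :: "real^'n^'m"
  by (simp add: matrix_vector_mul_component row_def)

lemma norm_matrix_vector_sq: "(norm (A *v v))\<^sup>2 = (\<Sum>k\<in>UNIV. (row k A \<bullet> v)\<^sup>2)" for A :: "real^'n^'m"
  by (simp add: norm_vec_def L2_set_def sum_nonneg matrix_vector_component_row)

text \<open>The direction \<open>sgn a\<close> of a zero row is the zero vector, and both sides then vanish.\<close>

lemma row_density_sgn:
  "row_density A k * (sgn (row k A) \<bullet> v)\<^sup>2 = (row k A \<bullet> v)\<^sup>2 / (frobenius_norm A)\<^sup>2"
  by (cases "row k A = 0")
     (simp_all add: row_density_def sgn_div_norm power_mult_distrib field_simps)

text \<open>The scaling \<open>1 / (s p\<^sub>k)\<close> of the sampled rows cancels their lengths, so that only the directions of the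
rows remain.\<close>

lemma row_sample_form:
  fixes A :: "real^'n^'m" and i :: "'s::finite \<Rightarrow> 'm"
  shows "(norm (row_sample A (row_density A) i *v v))\<^sup>2
    = (frobenius_norm A)\<^sup>2 / real CARD('s) * (\<Sum>t\<in>UNIV. (sgn (row (i t) A) \<bullet> v)\<^sup>2)"
proof -
  have "(row_sample A (row_density A) i *v v) $ t
      = (row (i t) A \<bullet> v) / sqrt (real CARD('s) * row_density A (i t))" for t
  proof -
    have "(row_sample A (row_density A) i *v v) $ t
        = (\<Sum>k\<in>UNIV. sampling_matrix (row_density A) i $ t $ k * (A *v v) $ k)"
      by (simp only: row_sample_def matrix_vector_mul_assoc[symmetric]
          matrix_vector_mult_def[of "sampling_matrix _ _"] vec_lambda_beta)
    also have "\<dots> = (\<Sum>k\<in>UNIV. if k = i t then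
        (row k A \<bullet> v) / sqrt (real CARD('s) * row_density A (i t)) else 0)"
      by (intro sum.cong refl) (simp add: sampling_matrix_def matrix_vector_component_row)
    finally show ?thesis by simp
  qed
  moreover have "((row k A \<bullet> v) / sqrt (real CARD('s) * row_density A k))\<^sup>2
      = (frobenius_norm A)\<^sup>2 / real CARD('s) * (sgn (row k A) \<bullet> v)\<^sup>2" for k
    by (cases "row k A = 0")
       (simp_all add: row_density_def sgn_div_norm power_mult_distrib power_divide real_sqrt_pow2 field_simps)
  moreover have "(norm w)\<^sup>2 = (\<Sum>t\<in>UNIV. (w $ t)\<^sup>2)" for w :: "real^'s"
    by (simp add: norm_vec_def L2_set_def sum_nonneg)
  ultimately show ?thesis by (simp only: sum_distrib_left)
qed

section \<open>Relative accuracy on high frequency vectors\<close>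

text \<open>Here \<open>\<sigma>\<close> stands for \<open>\<parallel>A\<parallel>\<^sup>2\<close> and \<open>\<kappa>\<close> for the largest eigenvalue of the Gram matrix.
The negated exponent equals \<open>s \<epsilon>\<^sup>2 \<kappa> / (4 n)\<close>, and \<open>s\<close> is at least
\<open>4 \<sigma> (n / \<epsilon>\<^sup>2) ln (2 n / \<delta>)\<close>, so it is at least \<open>ln (2 n / \<delta>)\<close>, as \<open>\<sigma> \<kappa> \<ge> 1\<close>.\<close>

lemma sample_size_suffices:
  fixes n s \<epsilon> \<delta> \<sigma> \<kappa> C :: real
  assumes n: "2 \<le> n" and \<epsilon>: "0 < \<epsilon>" and \<delta>: "0 < \<delta>" "\<delta> < 1"
    and \<sigma>: "1 \<le> \<sigma>" and \<kappa>: "1 \<le> \<kappa>"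
    and C: "C = 2 / 3 * (6 * \<sigma> + 2 * \<epsilon>) * (1 - log n (\<delta> / 2))"
    and s: "s = C * (1 / \<epsilon>\<^sup>2) * n * ln n"
  shows "n * exp (- (s * (\<epsilon>\<^sup>2 * \<kappa> / (2 * n) - (\<epsilon> / 2)\<^sup>2 * (\<kappa> / n)))) \<le> \<delta> / 2"
proof -
  have lnn: "0 < ln n" using n by simp
  define l where "l = ln (2 * n / \<delta>)"
  have "1 \<le> 2 * n / \<delta>" using n \<delta> by (simp add: le_divide_eq)
  then have l: "0 \<le> l" by (simp add: l_def)
  have "(1 - log n (\<delta> / 2)) * ln n = ln n - ln (\<delta> / 2)"
    using lnn by (simp add: log_def left_diff_distrib)
  also have "\<dots> = l" using n \<delta> by (simp add: l_def ln_div ln_mult)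
  finally have Cl: "C * ln n = 2 / 3 * (6 * \<sigma> + 2 * \<epsilon>) * l" by (simp add: C mult.assoc)
  have "4 * l \<le> 2 / 3 * (6 * \<sigma> + 2 * \<epsilon>) * l" using \<sigma> \<epsilon> l by (intro mult_right_mono) auto
  also have "\<dots> \<le> 2 / 3 * (6 * \<sigma> + 2 * \<epsilon>) * l * \<kappa>"
    using mult_left_mono[OF \<kappa>, of "2 / 3 * (6 * \<sigma> + 2 * \<epsilon>) * l"] \<sigma> \<epsilon> l by simp
  finally have "l \<le> C * ln n * \<kappa> / 4" by (simp add: Cl)
  also have "\<dots> = s * (\<epsilon>\<^sup>2 * \<kappa> / (2 * n) - (\<epsilon> / 2)\<^sup>2 * (\<kappa> / n))"
    using n \<epsilon> by (simp add: s power_divide field_simps)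
  finally have "exp (- (s * (\<epsilon>\<^sup>2 * \<kappa> / (2 * n) - (\<epsilon> / 2)\<^sup>2 * (\<kappa> / n)))) \<le> exp (- l)" by simp
  also have "\<dots> = \<delta> / (2 * n)" using n \<delta> by (simp add: l_def exp_minus)
  finally have "n * exp (- (s * (\<epsilon>\<^sup>2 * \<kappa> / (2 * n) - (\<epsilon> / 2)\<^sup>2 * (\<kappa> / n)))) \<le> n * (\<delta> / (2 * n))"
    by (rule mult_left_mono) (use n in auto)
  then show ?thesis using n by simp
qed

lemma form_deviation_from_unit_vectors:
  fixes F :: "real^'n^'m" and F' :: "real^'n^'s"
  assumes unit: "\<And>v. norm v = 1 \<Longrightarrow> \<bar>(norm (F' *v v))\<^sup>2 - (norm (F *v v))\<^sup>2\<bar> \<le> c"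
  shows "\<bar>(norm (F' *v x))\<^sup>2 - (norm (F *v x))\<^sup>2\<bar> \<le> c * (norm x)\<^sup>2"
proof (cases "x = 0")
  case False
  define v where "v = x /\<^sub>R norm x"
  have v: "norm v = 1" "x = norm x *\<^sub>R v" using False by (simp_all add: v_def)
  have scale: "(norm (B *v x))\<^sup>2 = (norm (B *v v))\<^sup>2 * (norm x)\<^sup>2" for B :: "real^'n^'k"
    by (subst v(2)) (simp add: matrix_vector_mult_scaleR power_mult_distrib mult.commute)
  have "\<bar>(norm (F' *v v))\<^sup>2 - (norm (F *v v))\<^sup>2\<bar> * (norm x)\<^sup>2 \<le> c * (norm x)\<^sup>2"
    by (rule mult_right_mono[OF unit[OF v(1)]]) simp
  then show ?thesis by (simp add: scale left_diff_distrib[symmetric] abs_mult)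
qed simp

theorem corollary3p8:
  fixes A :: "real^'n^'m"
    and \<epsilon> \<delta> C C\<^sub>h :: real
    and M :: "'w measure"
    and I :: "'s::finite \<Rightarrow> 'w \<Rightarrow> 'm"
  assumes "CARD('n) \<ge> 2"
    and "CARD('m) > CARD('n)"
    and "(frobenius_norm A)\<^sup>2 = real CARD('n)"
    and "0 < \<epsilon>" and "\<epsilon> < 1"
    and "0 < \<delta>" and "\<delta> < 1"
    and "C = 2 / 3 * (6 * (spectral_norm A)\<^sup>2 + 2 * \<epsilon>) * (1 - log (real CARD('n)) (\<delta> / 2))"
    and "real CARD('s) = C * (1 / \<epsilon>\<^sup>2) * real CARD('n) * ln (real CARD('n))"
    and "iid_draws M (row_density A) I"
    and "C\<^sub>h > 0"
  shows "\<P>(\<omega> in M. \<forall>x. high_frequency C\<^sub>h (transpose A ** A) x \<longrightarrow>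
           (let A\<^sub>s = row_sample A (row_density A) (\<lambda>t. I t \<omega>) in
              (1 - C\<^sub>h * \<epsilon>) * (((transpose A ** A) *v x) \<bullet> x) \<le> ((transpose A\<^sub>s ** A\<^sub>s) *v x) \<bullet> x \<and>
              ((transpose A\<^sub>s ** A\<^sub>s) *v x) \<bullet> x \<le> (1 + C\<^sub>h * \<epsilon>) * (((transpose A ** A) *v x) \<bullet> x)))
         \<ge> 1 - \<delta>"
proof -
  define n where "n = real CARD('n)"
  define s where "s = real CARD('s)"
  define p where "p = row_density A"
  define u where "u k = sgn (row k A)" for k
  define \<kappa> where "\<kappa> = lambda_max (transpose A ** A)"
  define q where "q v i = (\<Sum>t\<in>UNIV. (u (i t) \<bullet> v)\<^sup>2)" for v and i :: "'s \<Rightarrow> 'm"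
  define w where "w i = (\<Prod>t\<in>UNIV. p (i t))" for i :: "'s \<Rightarrow> 'm"
  define m where "m v = (\<Sum>k\<in>UNIV. p k * (u k \<bullet> v)\<^sup>2)" for v
  have n: "2 \<le> n" using assms(1) by (simp add: n_def)
  have s: "0 < s" by (simp add: s_def)
  note frob = assms(3)[folded n_def]
  have form_le: "(norm (A *v v))\<^sup>2 \<le> \<kappa> * (norm v)\<^sup>2" for v
    using quadratic_form_le_lambda_max[OF self_adjoint_gram, of A v] by (simp add: gram_form \<kappa>_def)
  \<comment> \<open>The squared Frobenius norm \<open>n\<close> is at most \<open>n \<kappa>\<close> and at most \<open>n \<parallel>A\<parallel>\<^sup>2\<close>.\<close>
  have \<kappa>1: "1 \<le> \<kappa>"
  proof -
    have "(norm (A *v v))\<^sup>2 \<le> \<kappa>" if "norm v = 1" for v using form_le[of v] that by simp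
    then show ?thesis using frobenius_sq_le[of A \<kappa>] frob n by (simp add: n_def)
  qed
  have \<sigma>1: "1 \<le> (spectral_norm A)\<^sup>2"
  proof -
    have "(norm (A *v v))\<^sup>2 \<le> (spectral_norm A)\<^sup>2" if "norm v = 1" for v
      using onorm[OF matrix_vector_mul_bounded_linear[of A], of v] that by (intro power_mono) auto
    then show ?thesis using frobenius_sq_le[of A "(spectral_norm A)\<^sup>2"] frob n by (simp add: n_def)
  qed
  have p0: "0 \<le> p k" for k by (simp add: p_def row_density_def)
  have p1: "(\<Sum>k\<in>UNIV. p k) = 1"
  proof -
    have "(\<Sum>k\<in>UNIV. p k) = (\<Sum>k\<in>UNIV. (norm (row k A))\<^sup>2) / n"
      by (simp add: p_def row_density_def frob sum_divide_distrib)
    also have "(\<Sum>k\<in>UNIV. (norm (row k A))\<^sup>2) = n"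
      unfolding frob[symmetric] by (simp add: norm_vec_def L2_set_def sum_nonneg row_def)
    finally show ?thesis using n by simp
  qed
  have u: "norm (u k) = 1" if "p k \<noteq> 0" for k
    using that by (auto simp: p_def u_def row_density_def norm_sgn)
  have m: "m v = (norm (A *v v))\<^sup>2 / n" for v
    by (simp add: m_def p_def u_def row_density_sgn frob norm_matrix_vector_sq sum_divide_distrib)
  have m_le: "m v \<le> \<kappa> / n" if "norm v = 1" for v
    using form_le[of v] that n by (simp add: m divide_right_mono)

  \<comment> \<open>Outcomes whose sampled form is off by at least \<open>\<epsilon> \<kappa>\<close> at some unit vector, above or below
    according to the sign of \<open>x\<close>; the threshold is \<open>\<bar>x\<bar> s \<epsilon> \<kappa> / n\<close> at \<open>\<bar>x\<bar> = \<epsilon> / 2\<close>.\<close>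
  define bad where "bad x = {i. \<exists>v. norm v = 1 \<and> s * (\<epsilon>\<^sup>2 * \<kappa> / (2 * n)) \<le> x * (q v i - s * m v)}" for x
  have bad: "(\<Sum>i\<in>bad x. w i) \<le> \<delta> / 2" if "x\<^sup>2 = (\<epsilon> / 2)\<^sup>2" for x
  proof -
    have "x = \<epsilon> / 2 \<or> x = - (\<epsilon> / 2)" using that by (simp only: power2_eq_iff)
    then have "\<bar>x\<bar> \<le> 1" using assms(4,5) by auto
    then have "(\<Sum>i\<in>bad x. w i) \<le> n * exp (- (s * (\<epsilon>\<^sup>2 * \<kappa> / (2 * n) - x\<^sup>2 * (\<kappa> / n))))"
      using rank_one_chernoff[where 's = 's and p = p and u = u and \<Lambda> = "\<kappa> / n" and x = x
          and \<tau> = "\<epsilon>\<^sup>2 * \<kappa> / (2 * n)", OF p0 p1 u m_le[unfolded m_def]]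
      by (simp add: bad_def q_def s_def m_def w_def n_def)
    also have "\<dots> \<le> \<delta> / 2"
      unfolding that using n assms(4,6,7) \<sigma>1 \<kappa>1 assms(8,9)
      by (intro sample_size_suffices[where C = C and \<sigma> = "(spectral_norm A)\<^sup>2"]) (simp_all add: n_def s_def)
    finally show ?thesis .
  qed

  define Good where "Good i \<longleftrightarrow> (\<forall>x. high_frequency C\<^sub>h (transpose A ** A) x \<longrightarrow>
           (let A\<^sub>s = row_sample A (row_density A) i in
              (1 - C\<^sub>h * \<epsilon>) * (((transpose A ** A) *v x) \<bullet> x) \<le> ((transpose A\<^sub>s ** A\<^sub>s) *v x) \<bullet> x \<and>
              ((transpose A\<^sub>s ** A\<^sub>s) *v x) \<bullet> x \<le> (1 + C\<^sub>h * \<epsilon>) * (((transpose A ** A) *v x) \<bullet> x)))"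
    for i :: "'s \<Rightarrow> 'm"
  have good: "Good i" if i: "i \<notin> bad (\<epsilon> / 2)" "i \<notin> bad (- (\<epsilon> / 2))" for i
    unfolding Good_def Let_def gram_form
  proof (intro allI impI)
    fix x assume x: "high_frequency C\<^sub>h (transpose A ** A) x"
    let ?F = "row_sample A (row_density A) i"
    have "\<bar>(norm (?F *v v))\<^sup>2 - (norm (A *v v))\<^sup>2\<bar> \<le> \<epsilon> * \<kappa>" if v: "norm v = 1" for v
    proof -
      have "s * (\<epsilon>\<^sup>2 * \<kappa> / (2 * n)) = (\<epsilon> / 2) * (s * \<epsilon> * \<kappa> / n)" by (simp add: power2_eq_square)
      moreover have "\<not> s * (\<epsilon>\<^sup>2 * \<kappa> / (2 * n)) \<le> (\<epsilon> / 2) * (q v i - s * m v)"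
        using i(1) v unfolding bad_def by blast
      moreover have "\<not> s * (\<epsilon>\<^sup>2 * \<kappa> / (2 * n)) \<le> - (\<epsilon> / 2) * (q v i - s * m v)"
        using i(2) v unfolding bad_def by blast
      ultimately have "(\<epsilon> / 2) * (q v i - s * m v) < (\<epsilon> / 2) * (s * \<epsilon> * \<kappa> / n)"
        "(\<epsilon> / 2) * - (q v i - s * m v) < (\<epsilon> / 2) * (s * \<epsilon> * \<kappa> / n)"
        by (simp_all only: not_le minus_mult_left minus_mult_right)
      then have "q v i - s * m v < s * \<epsilon> * \<kappa> / n" "- (q v i - s * m v) < s * \<epsilon> * \<kappa> / n"
        using assms(4) by (simp_all only: mult_less_cancel_left_pos half_gt_zero)
      then have "\<bar>q v i - s * m v\<bar> \<le> s * \<epsilon> * \<kappa> / n" by (simp only: abs_le_iff less_imp_le simp_thms)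
      then have "(n / s) * \<bar>q v i - s * m v\<bar> \<le> (n / s) * (s * \<epsilon> * \<kappa> / n)"
        using n s by (intro mult_left_mono) auto
      also have "(n / s) * \<bar>q v i - s * m v\<bar> = \<bar>(n / s) * (q v i - s * m v)\<bar>"
        using n s by (simp add: abs_mult)
      also have "(n / s) * (q v i - s * m v) = (norm (?F *v v))\<^sup>2 - (norm (A *v v))\<^sup>2"
        using n s by (simp add: row_sample_form frob q_def u_def m s_def right_diff_distrib)
      finally show ?thesis using n s by simp
    qed
    then have "\<bar>(norm (?F *v x))\<^sup>2 - (norm (A *v x))\<^sup>2\<bar> \<le> \<epsilon> * (\<kappa> * (norm x)\<^sup>2)"
      using form_deviation_from_unit_vectors[of ?F A "\<epsilon> * \<kappa>" x] by (simp add: mult.assoc)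
    \<comment> \<open>High frequency of \<open>x\<close> turns the bound relative to \<open>\<parallel>x\<parallel>\<^sup>2\<close> into one relative to the form.\<close>
    also have "\<dots> \<le> \<epsilon> * (C\<^sub>h * (norm (A *v x))\<^sup>2)"
      using x assms(4) by (intro mult_left_mono) (auto simp: high_frequency_def \<kappa>_def gram_form)
    finally show "(1 - C\<^sub>h * \<epsilon>) * (norm (A *v x))\<^sup>2 \<le> (norm (?F *v x))\<^sup>2 \<and>
        (norm (?F *v x))\<^sup>2 \<le> (1 + C\<^sub>h * \<epsilon>) * (norm (A *v x))\<^sup>2"
      by (auto simp: abs_le_iff algebra_simps)
  qed

  note law = prob_iid_draws[OF assms(10), folded p_def]
  interpret prob_space M using assms(10) by (simp add: iid_draws_def)
  have w0: "0 \<le> w i" for i unfolding w_def by (intro prod_nonneg) (simp add: p0)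
  have union_bound: "sum w (X \<union> X') \<le> sum w X + sum w X'" for X X'
    using sum_nonneg[of "X \<inter> X'" w] w0 by (simp add: sum_Un)
  have "(\<Sum>i\<in>UNIV. w i) = 1" using law[of "\<lambda>_. True"] by (simp add: w_def prob_space)
  moreover have "(\<Sum>i\<in>UNIV. w i) \<le> (\<Sum>i\<in>{i. Good i} \<union> (bad (\<epsilon> / 2) \<union> bad (- (\<epsilon> / 2))). w i)"
    using good by (intro sum_mono2) (auto simp: w0)
  moreover have "\<dots> \<le> (\<Sum>i | Good i. w i) + ((\<Sum>i\<in>bad (\<epsilon> / 2). w i) + (\<Sum>i\<in>bad (- (\<epsilon> / 2)). w i))"
    by (rule order_trans[OF union_bound add_left_mono[OF union_bound]])
  moreover have "(\<Sum>i\<in>bad (\<epsilon> / 2). w i) + (\<Sum>i\<in>bad (- (\<epsilon> / 2)). w i) \<le> \<delta> / 2 + \<delta> / 2"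
    by (intro add_mono bad) simp_all
  ultimately have "1 - \<delta> \<le> (\<Sum>i | Good i. w i)" by simp
  also have "\<dots> = \<P>(\<omega> in M. Good (\<lambda>t. I t \<omega>))" unfolding w_def by (rule law[symmetric])
  finally show ?thesis unfolding Good_def .
qed

end
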